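(* Let $W$ be the complex Lie algebra with basis $\{L_m, I_m \mid m\in\mathbb{Z}\}$ and bracket $[L_m,L_n]=(m-n)L_{m+n}$, $[L_m,I_n]=(m-n)I_{m+n}$, $[I_m,I_n]=0$ for all $m,n\in\mathbb{Z}$. Let $\widetilde W$ be the complex Lie algebra with basis $\{L_n,I_n,C_1,C_2\mid n\in\mathbb{Z}\}$ and relations $$[L_m,L_n]=(m-n)L_{m+n}+\delta_{m+n,0}\frac{m^3-m}{12}C_1,\quad [L_m,I_n]=(m-n)I_{m+n}+\delta_{m+n,0}\frac{m^3-m}{12}C_2,$$ $$[I_m,I_n]=0,\quad [C_1,\widetilde W]=[C_2,\widetilde W]=0$$ for all $m,n\in\mathbb{Z}$. Then $Aut(\widetilde W)\cong Aut(W)$, that is, $$Aut(\widetilde W)\cong\mathbb{C}^{\infty}\rtimes(\mathbb{Z}_2\ltimes(\mathbb{C}^*\times\mathbb{C}^* )),$$ where $\mathbb{C}^\infty=\{(a_i)_{i\in\mathbb{Z}}\mid a_i\in\mathbb{C},\ \text{all but finitely many } a_i \text{ are zero}\}$ is regarded as an abelian group under addition.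
   Context: In the semidirect products the normal factors are $\mathbb{C}^\infty$ (in the whole group) and $\mathbb{C}^*\times\mathbb{C}^*$ (in $\mathbb{Z}_2\ltimes(\mathbb{C}^*\times\mathbb{C}^* )$). The actions are those given by conjugation inside $Aut(W)$, under identifications of the factors with the following subgroups of $Aut(W)$. For $\epsilon\in\{\pm1\}$, $\lambda\in\mathbb{C}$, $a,\mu\in\mathbb{C}^*$, let $\bar\sigma(\epsilon,\lambda,a,\mu)$ be the automorphism of $W$ with $L_n\mapsto a^n\epsilon L_{\epsilon n}+a^n\lambda nI_{\epsilon n}$, $I_n\mapsto a^n\mu I_{\epsilon n}$. Then: - $\mathbb{Z}_2=\{\pm1\}$ corresponds to $\mathfrak a=\{\bar\sigma(\epsilon,0,1,1)\mid\epsilon=\pm1\}$; - $\mathbb{C}^*\times\mathbb{C}^*$ corresponds to $\mathfrak b=\{\bar\sigma(1,0,a,\mu)\mid a,\mu\in\mathbb{C}^*\}$; - $\mathbb{C}^\infty$ corresponds to $\mathfrak Z\mathfrak t$, where $\mathfrak t=\{\bar\sigma(1,\lambda,1,1)\mid\lambda\in\mathbb{C}\}$ and $\mathfrak Z$ is the subgroup of $Aut(W)$ generated by all $\exp(k\,\mathrm{ad}\,I_m)$, $k\in\mathbb{C}$, $m\in\mathbb{Z}$. *)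

theory Defs
  imports Complex_Main "HOL-Algebra.Generated_Groups"
begin

section \<open>Lie algebras and their automorphism groups\<close>

locale lie_algebra = vector_space scale
  for scale :: "'k::field \<Rightarrow> 'a::ab_group_add \<Rightarrow> 'a" (infixr "*s" 75)
    and bracket :: "'a \<Rightarrow> 'a \<Rightarrow> 'a" +
  assumes bracket_add_left: "bracket (x + y) z = bracket x z + bracket y z"
    and bracket_add_right: "bracket x (y + z) = bracket x y + bracket x z"
    and bracket_scale_left: "bracket (c *s x) y = c *s bracket x y"
    and bracket_scale_right: "bracket x (c *s y) = c *s bracket x y"
    and bracket_self: "bracket x x = 0"
    and jacobi: "bracket x (bracket y z) + bracket y (bracket z x) + bracket z (bracket x y) = 0"

definition lie_aut ::
  "('k::field \<Rightarrow> 'a::ab_group_add \<Rightarrow> 'a) \<Rightarrow> ('a \<Rightarrow> 'a \<Rightarrow> 'a) \<Rightarrow> ('a \<Rightarrow> 'a) monoid" where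
  "lie_aut scale bracket =
     \<lparr>carrier = {f. Vector_Spaces.linear scale scale f \<and> bij f \<and>
                   (\<forall>x y. f (bracket x y) = bracket (f x) (f y))},
      monoid.mult = (\<circ>), one = id\<rparr>"

text \<open>The exponential series of a locally nilpotent operator: at every point only
  finitely many of its terms are nonzero.\<close>

definition exp_loc_nilpotent ::
  "('k::field_char_0 \<Rightarrow> 'a::ab_group_add \<Rightarrow> 'a) \<Rightarrow> ('a \<Rightarrow> 'a) \<Rightarrow> 'a \<Rightarrow> 'a" where
  "exp_loc_nilpotent scale T x =
     (\<Sum>i | (T ^^ i) x \<noteq> 0. scale (1 / fact i) ((T ^^ i) x))"


section \<open>Semidirect products\<close>

text \<open>The normal factor is \<open>N\<close> and is written first.\<close>

definition semidirect ::
  "('a, 'c) monoid_scheme \<Rightarrow> ('b, 'd) monoid_scheme \<Rightarrow> ('b \<Rightarrow> 'a \<Rightarrow> 'a) \<Rightarrow> ('a \<times> 'b) monoid" where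
  "semidirect N H \<phi> =
     \<lparr>carrier = carrier N \<times> carrier H,
      monoid.mult = (\<lambda>(n, h) (n', h'). (n \<otimes>\<^bsub>N\<^esub> \<phi> h n', h \<otimes>\<^bsub>H\<^esub> h')),
      one = (\<one>\<^bsub>N\<^esub>, \<one>\<^bsub>H\<^esub>)\<rparr>"

text \<open>Given maps \<open>\<iota>\<close> and \<open>\<kappa>\<close> identifying \<open>N\<close> and \<open>H\<close> with subgroups of \<open>G\<close>, the action of
  \<open>H\<close> on \<open>N\<close> that corresponds to conjugation in \<open>G\<close>. It is meaningful only if
  the image of \<open>\<kappa>\<close> normalizes that of \<open>\<iota>\<close>, which is what \<open>acts_by_conj\<close> expresses.\<close>

definition conj_action ::
  "('g, 'c) monoid_scheme \<Rightarrow> ('a, 'd) monoid_scheme \<Rightarrow> ('a \<Rightarrow> 'g) \<Rightarrow> ('b \<Rightarrow> 'g) \<Rightarrow> 'b \<Rightarrow> 'a \<Rightarrow> 'a" where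
  "conj_action G N \<iota> \<kappa> h n =
     inv_into (carrier N) \<iota> (\<kappa> h \<otimes>\<^bsub>G\<^esub> \<iota> n \<otimes>\<^bsub>G\<^esub> inv\<^bsub>G\<^esub> (\<kappa> h))"

definition acts_by_conj ::
  "('g, 'c) monoid_scheme \<Rightarrow> ('a, 'd) monoid_scheme \<Rightarrow> ('b, 'e) monoid_scheme \<Rightarrow>
   ('a \<Rightarrow> 'g) \<Rightarrow> ('b \<Rightarrow> 'g) \<Rightarrow> ('b \<Rightarrow> 'a \<Rightarrow> 'a) \<Rightarrow> bool" where
  "acts_by_conj G N H \<iota> \<kappa> \<phi> \<longleftrightarrow>
     (\<forall>h \<in> carrier H. \<forall>n \<in> carrier N.
        \<phi> h n \<in> carrier N \<and> \<iota> (\<phi> h n) = \<kappa> h \<otimes>\<^bsub>G\<^esub> \<iota> n \<otimes>\<^bsub>G\<^esub> inv\<^bsub>G\<^esub> (\<kappa> h))"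


section \<open>The abstract factors\<close>

definition Z2 :: "int monoid" where
  "Z2 = \<lparr>carrier = {1, -1}, monoid.mult = (*), one = 1\<rparr>"

definition Cstar :: "complex monoid" where
  "Cstar = \<lparr>carrier = UNIV - {0}, monoid.mult = (*), one = 1\<rparr>"

definition Cinf :: "(int \<Rightarrow> complex) monoid" where
  "Cinf = \<lparr>carrier = {a. finite {i. a i \<noteq> 0}}, monoid.mult = (\<lambda>a b i. a i + b i), one = (\<lambda>i. 0)\<rparr>"


section \<open>The Lie algebra \<open>W\<close>\<close>

locale W_algebra = lie_algebra scale bracket
  for scale :: "complex \<Rightarrow> 'a::ab_group_add \<Rightarrow> 'a" (infixr "*s" 75)
    and bracket :: "'a \<Rightarrow> 'a \<Rightarrow> 'a" +
  fixes L I :: "int \<Rightarrow> 'a"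
  assumes basis_inj: "inj (case_sum L I)"
    and basis_independent: "independent (range (case_sum L I))"
    and basis_span: "span (range (case_sum L I)) = UNIV"
    and bracket_L_L: "bracket (L m) (L n) = of_int (m - n) *s L (m + n)"
    and bracket_L_I: "bracket (L m) (I n) = of_int (m - n) *s I (m + n)"
    and bracket_I_I: "bracket (I m) (I n) = 0"
begin

abbreviation AutW :: "('a \<Rightarrow> 'a) monoid" where
  "AutW \<equiv> lie_aut scale bracket"

definition sigma_bar :: "int \<Rightarrow> complex \<Rightarrow> complex \<Rightarrow> complex \<Rightarrow> 'a \<Rightarrow> 'a" where
  "sigma_bar \<epsilon> lam a mu = (THE f. f \<in> carrier AutW \<and>
     (\<forall>n. f (L n) = (a powi n * of_int \<epsilon>) *s L (\<epsilon> * n) + (a powi n * lam * of_int n) *s I (\<epsilon> * n)) \<and>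
     (\<forall>n. f (I n) = (a powi n * mu) *s I (\<epsilon> * n)))"

definition \<aa> :: "('a \<Rightarrow> 'a) set" where
  "\<aa> = {sigma_bar \<epsilon> 0 1 1 | \<epsilon>. \<epsilon> \<in> {1, -1}}"

definition \<bb> :: "('a \<Rightarrow> 'a) set" where
  "\<bb> = {sigma_bar 1 0 a mu | a mu. a \<noteq> 0 \<and> mu \<noteq> 0}"

definition \<tt> :: "('a \<Rightarrow> 'a) set" where
  "\<tt> = {sigma_bar 1 lam 1 1 | lam. True}"

definition \<ZZ> :: "('a \<Rightarrow> 'a) set" where
  "\<ZZ> = generate AutW {exp_loc_nilpotent scale (\<lambda>x. k *s bracket (I m) x) | k m. True}"

text \<open>The identifications of the abstract factors with subgroups of \<open>AutW\<close>.
  As the operators \<open>ad I\<^sub>i\<close> commute, \<open>iota_inf a\<close> is the product of all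
  \<open>exp (a\<^sub>i ad I\<^sub>i)\<close>.\<close>

definition iota_Z2 :: "int \<Rightarrow> 'a \<Rightarrow> 'a" where
  "iota_Z2 \<epsilon> = sigma_bar \<epsilon> 0 1 1"

definition iota_torus :: "complex \<times> complex \<Rightarrow> 'a \<Rightarrow> 'a" where
  "iota_torus = (\<lambda>(a, mu). sigma_bar 1 0 a mu)"

definition iota_inf :: "(int \<Rightarrow> complex) \<Rightarrow> 'a \<Rightarrow> 'a" where
  "iota_inf a = exp_loc_nilpotent scale (bracket (\<Sum>i | a i \<noteq> 0. a i *s I i))"

definition torus_action :: "int \<Rightarrow> complex \<times> complex \<Rightarrow> complex \<times> complex" where
  "torus_action = conj_action AutW (Cstar \<times>\<times> Cstar) iota_torus iota_Z2"

text \<open>\<open>\<int>\<^sub>2 \<ltimes> (\<complex>\<^sup>* \<times> \<complex>\<^sup>*)\<close>\<close>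

definition K :: "((complex \<times> complex) \<times> int) monoid" where
  "K = semidirect (Cstar \<times>\<times> Cstar) Z2 torus_action"

definition iota_K :: "(complex \<times> complex) \<times> int \<Rightarrow> 'a \<Rightarrow> 'a" where
  "iota_K = (\<lambda>(b, \<epsilon>). iota_torus b \<otimes>\<^bsub>AutW\<^esub> iota_Z2 \<epsilon>)"

definition K_action :: "(complex \<times> complex) \<times> int \<Rightarrow> (int \<Rightarrow> complex) \<Rightarrow> int \<Rightarrow> complex" where
  "K_action = conj_action AutW Cinf iota_inf iota_K"

text \<open>\<open>\<complex>\<^sup>\<infinity> \<rtimes> (\<int>\<^sub>2 \<ltimes> (\<complex>\<^sup>* \<times> \<complex>\<^sup>*))\<close>\<close>

definition Cinf_K :: "((int \<Rightarrow> complex) \<times> ((complex \<times> complex) \<times> int)) monoid" where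
  "Cinf_K = semidirect Cinf K K_action"

text \<open>The maps above are isomorphisms onto the prescribed subgroups, and the
  actions are given by conjugation in \<open>AutW\<close>.\<close>

definition identifications_valid :: bool where
  "identifications_valid \<longleftrightarrow>
     iota_Z2 \<in> iso Z2 (AutW\<lparr>carrier := \<aa>\<rparr>) \<and>
     iota_torus \<in> iso (Cstar \<times>\<times> Cstar) (AutW\<lparr>carrier := \<bb>\<rparr>) \<and>
     iota_inf \<in> iso Cinf (AutW\<lparr>carrier := \<ZZ> <#>\<^bsub>AutW\<^esub> \<tt>\<rparr>) \<and>
     acts_by_conj AutW (Cstar \<times>\<times> Cstar) Z2 iota_torus iota_Z2 torus_action \<and>
     acts_by_conj AutW Cinf K iota_inf iota_K K_action"

end


section \<open>The Lie algebra \<open>W\<close> with two central elements adjoined\<close>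

locale Wt_algebra = lie_algebra scale bracket
  for scale :: "complex \<Rightarrow> 'a::ab_group_add \<Rightarrow> 'a" (infixr "*s" 75)
    and bracket :: "'a \<Rightarrow> 'a \<Rightarrow> 'a" +
  fixes L I :: "int \<Rightarrow> 'a" and C1 C2 :: 'a
  assumes basis_inj: "inj (case_sum (case_sum L I) (case_bool C1 C2))"
    and basis_independent: "independent (range (case_sum (case_sum L I) (case_bool C1 C2)))"
    and basis_span: "span (range (case_sum (case_sum L I) (case_bool C1 C2))) = UNIV"
    and bracket_L_L: "bracket (L m) (L n) =
          of_int (m - n) *s L (m + n) + (if m + n = 0 then (of_int (m ^ 3 - m) / 12) *s C1 else 0)"
    and bracket_L_I: "bracket (L m) (I n) =
          of_int (m - n) *s I (m + n) + (if m + n = 0 then (of_int (m ^ 3 - m) / 12) *s C2 else 0)"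
    and bracket_I_I: "bracket (I m) (I n) = 0"
    and bracket_C1: "bracket C1 x = 0"
    and bracket_C2: "bracket C2 x = 0"

end

(*
The ideal J spanned by the I_n consists of the x with (ad x)^2 = 0, so every automorphism f of W
preserves it. Comparing top and bottom degrees of the eigenvectors f(L_k) of ad f(L_0) shows
f(L_0) = +-L_0 modulo J, hence f(L_n) = +-a^n L_{+-n} modulo J. After composition with the standard
automorphisms, f fixes every I_n and differs from the identity by a derivation into J, which is
inner; so f = id + ad x with x in J.

The center of the extension is spanned by C_1 and C_2, and the extension is perfect. An automorphism
is therefore determined by the one it induces on the quotient W, and each of the explicit
automorphisms of W lifts.
*)
theory Submission
  imports Defs
begin

section \<open>Bases indexed by a type\<close>

text \<open>An automorphism need not respect the grading of W by degree, so products are compared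
  where only one term survives, in the top degree. The coefficient of L_0 in f(L_0) then turns out
  to be the reciprocal of an integer; the same holds for the inverse automorphism, which leaves only
  1 and -1. The relation [L_m, L_n] = (m-n) L_{m+n} says nothing for m = n, so the scalars read off
  from it are multiplicative or additive only off the diagonal at first. As the ideal is abelian,
  exp(ad x) = id + ad x for x in it, and x -> exp(ad x) turns sums into compositions; it is
  injective because W has trivial center. This makes \<ZZ>\<tt> a copy of \<open>Cinf\<close>, with
  \<tt> supplying nothing but the exponentials of multiples of ad I_0. Both kinds of standard
  automorphisms lift: (ad x)^2 still vanishes for combinations x of the I_n in the extension, and
  since m^3 - m is odd in m, the diagonal ones extend by C_1 -> \<epsilon> C_1, C_2 -> \<mu>
  C_2.\<close>

locale indexed_basis = vector_space scale
  for scale :: "'k::field \<Rightarrow> 'a::ab_group_add \<Rightarrow> 'a" (infixr "*s" 75) +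
  fixes B :: "'i \<Rightarrow> 'a"
  assumes inj_B: "inj B"
    and independent_B: "independent (range B)"
    and span_B: "span (range B) = UNIV"
begin

text \<open>\<open>representation\<close> is a function of basis vectors. Reading it through the
  index type lets the same lemmas serve both algebras, indexed by \<open>int + int\<close> and by
  \<open>(int + int) + bool\<close>.\<close>

definition coord :: "'a \<Rightarrow> 'i \<Rightarrow> 'k" where
  "coord x i = representation (range B) x (B i)"

lemma coord_add: "coord (x + y) i = coord x i + coord y i"
  using representation_add[OF independent_B] span_B by (simp add: coord_def)

lemma coord_scale: "coord (c *s x) i = c * coord x i"
  using representation_scale[OF independent_B] span_B by (simp add: coord_def)

lemma coord_basis: "coord (B j) i = (if i = j then 1 else 0)"
  using representation_basis[OF independent_B, of "B j"] inj_B
  by (auto simp: coord_def inj_eq)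

lemma finite_coord: "finite {i. coord x i \<noteq> 0}"
  using finite_vimageI[OF finite_representation[of "range B" x] inj_B]
  by (simp add: coord_def vimage_def)

lemma basis_expansion: "(\<Sum>i | coord x i \<noteq> 0. coord x i *s B i) = x"
proof -
  have "{b. representation (range B) x b \<noteq> 0} = B ` {i. coord x i \<noteq> 0}"
    using representation_ne_zero[of "range B" x] by (auto simp: coord_def)
  moreover have "inj_on B {i. coord x i \<noteq> 0}"
    using inj_B by (rule inj_on_subset) simp
  ultimately have "(\<Sum>b | representation (range B) x b \<noteq> 0. representation (range B) x b *s b)
      = (\<Sum>i | coord x i \<noteq> 0. coord x i *s B i)"
    by (simp only: sum.reindex o_def) (simp only: coord_def)
  then show ?thesis
    using sum_nonzero_representation_eq[OF independent_B, of x] span_B by simp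
qed

lemma coord_ext: "(\<And>i. coord x i = coord y i) \<Longrightarrow> x = y"
  using basis_expansion[of x] basis_expansion[of y] by presburger

lemma basis_induct [case_names basis add scale]:
  assumes "\<And>i. P (B i)"
    and "\<And>x y. P x \<Longrightarrow> P y \<Longrightarrow> P (x + y)"
    and "\<And>c x. P x \<Longrightarrow> P (c *s x)"
  shows "P x"
proof -
  have "x \<in> span (range B)"
    using span_B by simp
  then show ?thesis
  proof (induction rule: span_induct_alt)
    case base
    show ?case
      using assms(3)[OF assms(1), of 0] by simp
  next
    case (step c x y)
    then obtain i where "x = B i"
      by blast
    then show ?case
      using step.IH assms(2)[OF assms(3)[OF assms(1)]] by simp
  qed
qed

lemma linear_extension:
  assumes "vector_space scale'"
  obtains f where "Vector_Spaces.linear scale scale' f" "\<And>i. f (B i) = g i"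
proof -
  interpret V: vector_space_pair scale scale'
    using assms vector_space_axioms by (simp add: vector_space_pair_def)
  obtain f where f: "Vector_Spaces.linear scale scale' f" "\<forall>x\<in>range B. f x = g (inv_into UNIV B x)"
    using V.linear_independent_extend[OF independent_B, of "\<lambda>v. g (inv_into UNIV B v)"] by metis
  then have "f (B i) = g i" for i
    using inv_f_f[OF inj_B] by simp
  then show thesis
    using that f(1) by blast
qed

end

lemma linear_add: "Vector_Spaces.linear s s' f \<Longrightarrow> f (x + y) = f x + f y"
  and linear_scale: "Vector_Spaces.linear s s' f \<Longrightarrow> f (s c x) = s' c (f x)"
  by (simp_all add: Vector_Spaces.linear_iff)

lemma linear_zero: "Vector_Spaces.linear s s' f \<Longrightarrow> f 0 = 0"
  and linear_neg: "Vector_Spaces.linear s s' f \<Longrightarrow> f (- x) = - f x"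
  and linear_diff: "Vector_Spaces.linear s s' f \<Longrightarrow> f (x - y) = f x - f y"
proof -
  assume f: "Vector_Spaces.linear s s' f"
  interpret Vector_Spaces.linear s s' f by fact
  show "f 0 = 0" "f (- x) = - f x" "f (x - y) = f x - f y"
    by (simp_all add: zero neg diff)
qed

lemma linear_sum: "Vector_Spaces.linear s s' f \<Longrightarrow> f (sum g S) = (\<Sum>i\<in>S. f (g i))"
proof -
  assume f: "Vector_Spaces.linear s s' f"
  interpret Vector_Spaces.linear s s' f by fact
  show ?thesis by (rule sum)
qed

lemma linear_inverse:
  assumes f: "Vector_Spaces.linear s s' f" and "bij f"
  shows "Vector_Spaces.linear s' s (inv_into UNIV f)"
proof -
  have fi: "f (inv_into UNIV f x) = x" for x
    using \<open>bij f\<close> by (simp add: bij_is_surj surj_f_inv_f)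
  have "inv_into UNIV f (x + y) = inv_into UNIV f x + inv_into UNIV f y" for x y
    by (rule inv_f_eq) (simp_all add: \<open>bij f\<close> bij_is_inj linear_add[OF f] fi)
  moreover have "inv_into UNIV f (s' c x) = s c (inv_into UNIV f x)" for c x
    by (rule inv_f_eq) (simp_all add: \<open>bij f\<close> bij_is_inj linear_scale[OF f] fi)
  ultimately show ?thesis
    using f by (simp add: Vector_Spaces.linear_iff)
qed

lemma linear_comp:
  "Vector_Spaces.linear s s' f \<Longrightarrow> Vector_Spaces.linear s' s'' g \<Longrightarrow> Vector_Spaces.linear s s'' (g \<circ> f)"
  by (simp add: Vector_Spaces.linear_iff)

lemma (in indexed_basis) linear_ext:
  assumes f: "Vector_Spaces.linear scale s' f" and g: "Vector_Spaces.linear scale s' g"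
    and "\<And>i. f (B i) = g (B i)"
  shows "f = g"
proof
  show "f x = g x" for x
    by (induction x rule: basis_induct)
      (simp_all add: assms(3) linear_add[OF f] linear_add[OF g] linear_scale[OF f] linear_scale[OF g])
qed


section \<open>Lie algebra automorphisms\<close>

lemma lie_aut_simps [simp]:
  "x \<otimes>\<^bsub>lie_aut s b\<^esub> y = x \<circ> y" "\<one>\<^bsub>lie_aut s b\<^esub> = id"
  by (simp_all add: lie_aut_def)

lemma lie_aut_iff:
  "f \<in> carrier (lie_aut s b) \<longleftrightarrow>
     Vector_Spaces.linear s s f \<and> bij f \<and> (\<forall>x y. f (b x y) = b (f x) (f y))"
  by (simp add: lie_aut_def)

context lie_algebra
begin

abbreviation Aut :: "('a \<Rightarrow> 'a) monoid" where
  "Aut \<equiv> lie_aut scale bracket"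

lemma
  assumes "f \<in> carrier Aut"
  shows aut_linear: "Vector_Spaces.linear scale scale f"
    and aut_bij: "bij f"
    and aut_bracket: "f (bracket x y) = bracket (f x) (f y)"
  using assms by (simp_all add: lie_aut_iff)

lemma linear_bracket: "Vector_Spaces.linear scale scale (bracket x)"
  by (simp add: Vector_Spaces.linear_iff vector_space_axioms bracket_add_right bracket_scale_right)

lemma linear_bracket_left: "Vector_Spaces.linear scale scale (\<lambda>x. bracket x y)"
  by (simp add: Vector_Spaces.linear_iff vector_space_axioms bracket_add_left bracket_scale_left)

lemma bracket_zero [simp]: "bracket 0 x = 0" "bracket x 0 = 0"
  using linear_zero[OF linear_bracket] linear_zero[OF linear_bracket_left] by blast+

lemma bracket_diff_left: "bracket (x - y) z = bracket x z - bracket y z"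
  and bracket_diff_right: "bracket x (y - z) = bracket x y - bracket x z"
  and bracket_minus_right: "bracket x (- y) = - bracket x y"
  and bracket_minus_left: "bracket (- x) y = - bracket x y"
  using linear_diff[OF linear_bracket_left] linear_diff[OF linear_bracket] linear_neg[OF linear_bracket]
    linear_neg[OF linear_bracket_left]
  by blast+

lemma bracket_sym: "bracket x y = - bracket y x"
proof -
  have "bracket x y + bracket y x = bracket (x + y) (x + y)"
    unfolding bracket_add_left bracket_add_right by (simp add: bracket_self)
  then show ?thesis
    unfolding eq_neg_iff_add_eq_0 by (rule trans) (rule bracket_self)
qed

lemma bracket_derivation: "bracket x (bracket y z) = bracket (bracket x y) z + bracket y (bracket x z)"
proof -
  have "bracket x (bracket y z) - bracket y (bracket x z) - bracket (bracket x y) z = 0"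
    using jacobi[of x y z] bracket_sym[of z x] bracket_sym[of z "bracket x y"]
    by (simp add: bracket_minus_right)
  then show ?thesis
    by (simp add: algebra_simps)
qed

lemma aut_comp: "f \<in> carrier Aut \<Longrightarrow> g \<in> carrier Aut \<Longrightarrow> f \<circ> g \<in> carrier Aut"
  using linear_comp by (auto simp: lie_aut_iff intro: bij_comp)

lemma aut_id: "id \<in> carrier Aut"
  by (simp add: lie_aut_iff Vector_Spaces.linear_iff vector_space_axioms)

lemma aut_inv:
  assumes f: "f \<in> carrier Aut"
  shows "inv_into UNIV f \<in> carrier Aut"
proof -
  have fi: "f (inv_into UNIV f x) = x" for x
    using aut_bij[OF f] by (simp add: bij_is_surj surj_f_inv_f)
  have "inv_into UNIV f (bracket x y) = bracket (inv_into UNIV f x) (inv_into UNIV f y)" for x y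
    by (rule inv_f_eq) (simp_all add: aut_bij[OF f] bij_is_inj aut_bracket[OF f] fi)
  then show ?thesis
    using linear_inverse[OF aut_linear[OF f] aut_bij[OF f]] aut_bij[OF f]
    by (simp add: lie_aut_iff bij_imp_bij_inv)
qed

lemma group_Aut: "group Aut"
proof (rule groupI)
  show "\<exists>g\<in>carrier Aut. g \<otimes>\<^bsub>Aut\<^esub> f = \<one>\<^bsub>Aut\<^esub>" if "f \<in> carrier Aut" for f
    using aut_inv[OF that] bij_is_inj[OF aut_bij[OF that]]
    by (intro bexI[of _ "inv_into UNIV f"]) simp_all
qed (auto simp: aut_comp aut_id)

lemma inv_Aut_eq:
  assumes "f \<in> carrier Aut" "g \<in> carrier Aut" "f \<circ> g = id"
  shows "inv\<^bsub>Aut\<^esub> f = g"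
proof -
  have "inv\<^bsub>Aut\<^esub> g = f"
    using group.inv_equality[OF group_Aut, of f g] assms by simp
  then show ?thesis
    using group.inv_inv[OF group_Aut assms(2)] by simp
qed

end

lemma (in indexed_basis) preserves_bracket:
  assumes "lie_algebra scale b" "lie_algebra s' b'"
    and f: "Vector_Spaces.linear scale s' f"
    and eq: "\<And>i j. f (b (B i) (B j)) = b' (f (B i)) (f (B j))"
  shows "f (b x y) = b' (f x) (f y)"
proof -
  interpret A: lie_algebra scale b by fact
  interpret A': lie_algebra s' b' by fact
  note simps = linear_add[OF f] linear_scale[OF f] A.bracket_add_left A.bracket_scale_left
    A.bracket_add_right A.bracket_scale_right A'.bracket_add_left A'.bracket_scale_left
    A'.bracket_add_right A'.bracket_scale_right
  have "f (b (B i) y) = b' (f (B i)) (f y)" for i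
    by (induction y rule: basis_induct) (simp_all add: eq simps)
  then show ?thesis
    by (induction x rule: basis_induct) (simp_all add: simps)
qed

text \<open>If \<open>(ad x)\<^sup>2 = 0\<close>, the Leibniz rule for \<open>(ad x)\<^sup>2\<close> gives
  \<open>2 [[x, y], [x, z]] = 0\<close>, so that \<open>exp (ad x) = id + ad x\<close> is an automorphism.\<close>

lemma (in lie_algebra) aut_id_plus_ad:
  assumes sq: "\<And>y. bracket x (bracket x y) = 0" and two: "(2 :: 'k) \<noteq> 0"
  shows "(\<lambda>y. y + bracket x y) \<in> carrier Aut"
proof -
  have zero: "bracket (bracket x y) (bracket x z) = 0" for y z
  proof -
    have "0 = bracket x (bracket x (bracket y z))"
      by (simp add: sq)
    also have "\<dots> = bracket (bracket x y) (bracket x z) + bracket (bracket x y) (bracket x z)"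
      by (simp only: bracket_derivation[of x y z] bracket_add_right
          bracket_derivation[of x "bracket x y" z] bracket_derivation[of x y "bracket x z"] sq) simp
    also have "\<dots> = 2 *s bracket (bracket x y) (bracket x z)"
      by (metis one_add_one scale_left_distrib scale_one)
    finally show ?thesis
      using two by simp
  qed
  have "bij (\<lambda>y. y + bracket x y)"
    by (rule o_bij[of "\<lambda>y. y - bracket x y"])
      (simp_all add: fun_eq_iff bracket_add_right bracket_diff_right sq)
  then show ?thesis
    by (auto simp: lie_aut_iff Vector_Spaces.linear_iff vector_space_axioms bracket_add_right bracket_add_left
        scale_right_distrib bracket_scale_right bracket_derivation[of x] zero)
qed

section \<open>Coordinates on \<open>W\<close>\<close>

sublocale W_algebra \<subseteq> basis: indexed_basis scale "case_sum L I"
  by unfold_locales (fact basis_inj basis_independent basis_span)+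

context W_algebra
begin

definition cL :: "'a \<Rightarrow> int \<Rightarrow> complex" where
  "cL x n = basis.coord x (Inl n)"

definition cI :: "'a \<Rightarrow> int \<Rightarrow> complex" where
  "cI x n = basis.coord x (Inr n)"

lemma cL_simps [simp]:
  "cL (x + y) n = cL x n + cL y n"
  "cL (c *s x) n = c * cL x n"
  "cL (L m) n = (if n = m then 1 else 0)"
  "cL (I m) n = 0"
  using basis.coord_basis[of "Inl m" "Inl n"] basis.coord_basis[of "Inr m" "Inl n"]
  by (simp_all add: cL_def basis.coord_add basis.coord_scale)

lemma cI_simps [simp]:
  "cI (x + y) n = cI x n + cI y n"
  "cI (c *s x) n = c * cI x n"
  "cI (L m) n = 0"
  "cI (I m) n = (if n = m then 1 else 0)"
  using basis.coord_basis[of "Inl m" "Inr n"] basis.coord_basis[of "Inr m" "Inr n"]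
  by (simp_all add: cI_def basis.coord_add basis.coord_scale)

lemma linear_cL: "Vector_Spaces.linear scale (*) (\<lambda>x. cL x n)"
  and linear_cI: "Vector_Spaces.linear scale (*) (\<lambda>x. cI x n)"
  by (simp_all add: Vector_Spaces.linear_iff vector_space_axioms)
    (simp_all add: vector_space_def algebra_simps)

lemma cL_simps' [simp]:
  "cL 0 n = 0" "cL (- x) n = - cL x n" "cL (x - y) n = cL x n - cL y n"
  "cL (sum g S) n = (\<Sum>i\<in>S. cL (g i) n)"
  by (fact linear_zero[OF linear_cL] linear_neg[OF linear_cL] linear_diff[OF linear_cL]
      linear_sum[OF linear_cL])+

lemma cI_simps' [simp]:
  "cI 0 n = 0" "cI (- x) n = - cI x n" "cI (x - y) n = cI x n - cI y n"
  "cI (sum g S) n = (\<Sum>i\<in>S. cI (g i) n)"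
  by (fact linear_zero[OF linear_cI] linear_neg[OF linear_cI] linear_diff[OF linear_cI]
      linear_sum[OF linear_cI])+

lemma finite_cL: "finite {n. cL x n \<noteq> 0}"
  using finite_vimageI[OF basis.finite_coord[of x], of Inl] by (simp add: cL_def vimage_def)

lemma finite_cI: "finite {n. cI x n \<noteq> 0}"
  using finite_vimageI[OF basis.finite_coord[of x], of Inr] by (simp add: cI_def vimage_def)

lemma W_eqI:
  assumes "\<And>n. cL x n = cL y n" "\<And>n. cI x n = cI y n"
  shows "x = y"
proof (rule basis.coord_ext)
  show "basis.coord x i = basis.coord y i" for i
    using assms by (cases i) (simp_all add: cL_def cI_def)
qed

lemma W_induct [case_names L I add scale]:
  assumes "\<And>n. P (L n)" "\<And>n. P (I n)"
    and "\<And>x y. P x \<Longrightarrow> P y \<Longrightarrow> P (x + y)" "\<And>c x. P x \<Longrightarrow> P (c *s x)"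
  shows "P x"
proof (induction x rule: basis.basis_induct)
  case (basis i)
  then show ?case
    using assms(1,2) by (cases i) simp_all
qed (use assms in blast)+

lemma W_linear_ext:
  assumes "Vector_Spaces.linear scale s' f" "Vector_Spaces.linear scale s' g"
    and "\<And>n. f (L n) = g (L n)" "\<And>n. f (I n) = g (I n)"
  shows "f = g"
proof (rule basis.linear_ext[OF assms(1,2)])
  show "f (case_sum L I i) = g (case_sum L I i)" for i
    using assms(3,4) by (cases i) simp_all
qed

lemma bracket_I_L: "bracket (I m) (L n) = of_int (m - n) *s I (m + n)"
proof -
  have "bracket (I m) (L n) = - (of_int (n - m) *s I (n + m))"
    using bracket_sym[of "I m" "L n"] by (simp only: bracket_L_I)
  then show ?thesis
    by (simp add: add.commute flip: scale_minus_left)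
qed

text \<open>Only the component of \<open>y\<close> in degree k - i reaches degree k, with structure
  constant i - (k - i) = 2 i - k.\<close>

lemma cL_bracket_L: "cL (bracket (L i) y) k = of_int (2 * i - k) * cL y (k - i)"
proof (induction y rule: W_induct)
  case (scale c x)
  then show ?case
    by (simp add: bracket_scale_right mult.left_commute)
qed (auto simp: bracket_L_L bracket_L_I bracket_add_right bracket_scale_right algebra_simps)

lemma cI_bracket_L: "cI (bracket (L i) y) k = of_int (2 * i - k) * cI y (k - i)"
proof (induction y rule: W_induct)
  case (scale c x)
  then show ?case
    by (simp add: bracket_scale_right mult.left_commute)
qed (auto simp: bracket_L_L bracket_L_I bracket_add_right bracket_scale_right algebra_simps)

lemma cL_bracket_I: "cL (bracket (I i) y) k = 0"
proof (induction y rule: W_induct)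
  case (scale c x)
  then show ?case
    by (simp add: bracket_scale_right mult.left_commute)
qed (auto simp: bracket_I_L bracket_I_I bracket_add_right bracket_scale_right algebra_simps)

lemma cI_bracket_I: "cI (bracket (I i) y) k = of_int (2 * i - k) * cL y (k - i)"
proof (induction y rule: W_induct)
  case (scale c x)
  then show ?case
    by (simp add: bracket_scale_right mult.left_commute)
qed (auto simp: bracket_I_L bracket_I_I bracket_add_right bracket_scale_right algebra_simps)


section \<open>The abelian ideal spanned by the I_n, and the trivial center of W\<close>

definition J :: "'a set" where
  "J = {x. \<forall>n. cL x n = 0}"

lemma J_closed [simp]:
  "I n \<in> J" "0 \<in> J" "x \<in> J \<Longrightarrow> y \<in> J \<Longrightarrow> x + y \<in> J" "x \<in> J \<Longrightarrow> c *s x \<in> J"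
  "x \<in> J \<Longrightarrow> y \<in> J \<Longrightarrow> x - y \<in> J" "x \<in> J \<Longrightarrow> - x \<in> J"
  "(\<And>i. i \<in> S \<Longrightarrow> g i \<in> J) \<Longrightarrow> sum g S \<in> J"
  by (simp_all add: J_def)

lemma L_notin_J: "L n \<notin> J"
  unfolding J_def by (metis (mono_tags) cL_simps(3) mem_Collect_eq zero_neq_one)

text \<open>\<open>J\<close> is defined by vanishing coordinates; this recovers it as a span.
  \<open>S\<close> may exceed the support, so that \<open>{n}\<close> or the support itself can be
  inserted.\<close>

lemma J_expansion:
  assumes "x \<in> J" "finite S" "\<And>i. i \<notin> S \<Longrightarrow> cI x i = 0"
  shows "x = (\<Sum>i\<in>S. cI x i *s I i)"
  using assms by (intro W_eqI) (auto simp: J_def if_distrib cong: if_cong)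

lemma J_induct [consumes 1, case_names I add scale]:
  assumes "x \<in> J" and "\<And>n. P (I n)"
    and "\<And>x y. P x \<Longrightarrow> P y \<Longrightarrow> P (x + y)" "\<And>c x. P x \<Longrightarrow> P (c *s x)"
  shows "P x"
proof -
  have "P (\<Sum>i\<in>S. cI x i *s I i)" if "finite S" for S
    using that
  proof induction
    case empty
    show ?case
      using assms(4)[OF assms(2), of 0] by simp
  next
    case (insert i S)
    then show ?case
      using assms(2-4) by simp
  qed
  then show ?thesis
    using J_expansion[OF \<open>x \<in> J\<close> finite_cI] finite_cI[of x] by force
qed

lemma bracket_J_left: "x \<in> J \<Longrightarrow> bracket x y \<in> J"
proof (induction x rule: J_induct)
  case (I n)
  then show ?case
    by (simp add: J_def cL_bracket_I)
qed (simp_all add: bracket_add_left bracket_scale_left)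

lemma bracket_J_J: "x \<in> J \<Longrightarrow> y \<in> J \<Longrightarrow> bracket x y = 0"
proof (induction x rule: J_induct)
  case (I n)
  then show ?case
    by (intro W_eqI) (simp_all add: J_def cL_bracket_I cI_bracket_I)
qed (simp_all add: bracket_add_left bracket_scale_left)

text \<open>Since \<open>J\<close> is an ideal, \<open>x\<close> can be replaced by its L-part
  \<open>z\<close> without changing the L-coordinates of the bracket.\<close>

lemma cL_bracket:
  assumes S: "finite S" "\<And>i. i \<notin> S \<Longrightarrow> cL x i = 0"
  shows "cL (bracket x y) k = (\<Sum>i\<in>S. of_int (2 * i - k) * cL x i * cL y (k - i))"
proof -
  define z where "z = (\<Sum>i\<in>S. cL x i *s L i)"
  have "x - z \<in> J"
    using S by (auto simp: J_def z_def if_distrib cong: if_cong)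
  then have "cL (bracket (x - z) y) k = 0"
    using bracket_J_left[of "x - z" y] by (simp add: J_def)
  moreover have "bracket z y = (\<Sum>i\<in>S. cL x i *s bracket (L i) y)"
    unfolding z_def linear_sum[OF linear_bracket_left] by (simp add: bracket_scale_left)
  ultimately show ?thesis
    by (simp add: bracket_diff_left cL_bracket_L mult_ac)
qed

lemma center_W:
  assumes "\<And>y. bracket x y = 0"
  shows "x = 0"
proof (rule W_eqI)
  fix n
  \<comment> \<open>The index n + 1 is chosen so that the structure constant in degree 2 n + 1 is 2
    (n + 1) - (2 n + 1) = 1; that coordinate of the bracket is then exactly the n-th coordinate of
    \<open>x\<close>.\<close>
  have "bracket (L (n + 1)) x = 0"
    using bracket_sym[of "L (n + 1)" x] assms by simp
  then show "cL x n = cL 0 n" "cI x n = cI 0 n"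
    using cL_bracket_L[of "n + 1" x "2 * n + 1"] cI_bracket_L[of "n + 1" x "2 * n + 1"]
    by simp_all
qed


section \<open>The standard automorphisms of \<open>W\<close>\<close>

text \<open>For \<open>x\<close> in \<open>J\<close> this is exp(ad x), whose series stops after the
  linear term.\<close>

definition E :: "'a \<Rightarrow> 'a \<Rightarrow> 'a" where
  "E x = (\<lambda>y. y + bracket x y)"

lemma E_aut: "x \<in> J \<Longrightarrow> E x \<in> carrier AutW"
  unfolding E_def by (rule aut_id_plus_ad) (simp_all add: bracket_J_J bracket_J_left)

text \<open>The cross term [x, [y, z]] vanishes because [y, z] lies in the abelian ideal
  \<open>J\<close>.\<close>

lemma E_comp: "x \<in> J \<Longrightarrow> y \<in> J \<Longrightarrow> E x \<circ> E y = E (x + y)"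
  by (simp add: E_def fun_eq_iff bracket_add_left bracket_add_right bracket_J_J bracket_J_left
      algebra_simps)

lemma E_inj: "E x = E y \<Longrightarrow> x = y"
  using center_W[of "x - y"] by (simp add: E_def fun_eq_iff bracket_diff_left)

lemma E_conj:
  assumes "f \<in> carrier AutW"
  shows "f \<circ> E x = E (f x) \<circ> f"
  by (simp add: fun_eq_iff E_def linear_add[OF aut_linear[OF assms]] aut_bracket[OF assms])

text \<open>This is \<open>sigma_bar\<close> with \<open>lam = 0\<close>, chosen among linear maps
  instead of automorphisms, so that its values are at hand before it is known to be an
  automorphism.\<close>

definition U :: "int \<Rightarrow> complex \<Rightarrow> complex \<Rightarrow> 'a \<Rightarrow> 'a" where
  "U \<epsilon> a \<mu> = (SOME f. Vector_Spaces.linear scale scale f \<and>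
     (\<forall>n. f (L n) = (a powi n * of_int \<epsilon>) *s L (\<epsilon> * n)) \<and> (\<forall>n. f (I n) = (a powi n * \<mu>) *s I (\<epsilon> * n)))"

lemma
  shows U_linear: "Vector_Spaces.linear scale scale (U \<epsilon> a \<mu>)"
    and U_L: "U \<epsilon> a \<mu> (L n) = (a powi n * of_int \<epsilon>) *s L (\<epsilon> * n)"
    and U_I: "U \<epsilon> a \<mu> (I n) = (a powi n * \<mu>) *s I (\<epsilon> * n)"
proof -
  obtain f where f: "Vector_Spaces.linear scale scale f"
    "\<And>i. f (case_sum L I i) = case_sum (\<lambda>n. (a powi n * of_int \<epsilon>) *s L (\<epsilon> * n))
       (\<lambda>n. (a powi n * \<mu>) *s I (\<epsilon> * n)) i"
    by (rule basis.linear_extension[OF vector_space_axioms, of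
          "case_sum (\<lambda>n. (a powi n * of_int \<epsilon>) *s L (\<epsilon> * n)) (\<lambda>n. (a powi n * \<mu>) *s I (\<epsilon> * n))"])
      blast
  have "f (L n) = (a powi n * of_int \<epsilon>) *s L (\<epsilon> * n)" "f (I n) = (a powi n * \<mu>) *s I (\<epsilon> * n)" for n
    using f(2)[of "Inl n"] f(2)[of "Inr n"] by simp_all
  then have "\<exists>f. Vector_Spaces.linear scale scale f \<and> (\<forall>n. f (L n) = (a powi n * of_int \<epsilon>) *s L (\<epsilon> * n))
     \<and> (\<forall>n. f (I n) = (a powi n * \<mu>) *s I (\<epsilon> * n))"
    using f(1) by blast
  from someI_ex[OF this, folded U_def] show
    "Vector_Spaces.linear scale scale (U \<epsilon> a \<mu>)"
    "U \<epsilon> a \<mu> (L n) = (a powi n * of_int \<epsilon>) *s L (\<epsilon> * n)"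
    "U \<epsilon> a \<mu> (I n) = (a powi n * \<mu>) *s I (\<epsilon> * n)"
    by blast+
qed

text \<open>The inner map moves degree n to \<epsilon>' n, so the outer one contributes a to the
  power \<epsilon>' n. This twist is the source of the action of the sign group on the
  torus.\<close>

lemma U_comp:
  assumes "a \<noteq> 0" "a' \<noteq> 0"
  shows "U \<epsilon> a \<mu> \<circ> U \<epsilon>' a' \<mu>' = U (\<epsilon> * \<epsilon>') (a' * a powi \<epsilon>') (\<mu> * \<mu>')"
proof -
  have "(a powi n) powi \<epsilon>' = (a powi \<epsilon>') powi n" for n
    by (simp add: mult.commute flip: power_int_mult)
  then show ?thesis
    by (intro W_linear_ext[OF linear_comp[OF U_linear U_linear] U_linear])
      (simp_all add: U_L U_I linear_scale[OF U_linear] power_int_mult_distrib power_int_mult mult_ac)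
qed

lemma U_id: "U 1 1 1 = id"
  by (rule W_linear_ext[OF U_linear]) (simp_all add: U_L U_I Vector_Spaces.linear_iff vector_space_axioms)

lemma U_inverse:
  assumes "\<epsilon> \<in> {1, -1}" "a \<noteq> 0" "\<mu> \<noteq> 0"
  shows "U \<epsilon> a \<mu> \<circ> U \<epsilon> (a powi - \<epsilon>) (inverse \<mu>) = id" "U \<epsilon> (a powi - \<epsilon>) (inverse \<mu>) \<circ> U \<epsilon> a \<mu> = id"
  using assms by (auto simp: U_comp U_id power_int_minus)

lemma U_aut:
  assumes "\<epsilon> \<in> {1, -1}" "a \<noteq> 0" "\<mu> \<noteq> 0"
  shows "U \<epsilon> a \<mu> \<in> carrier AutW"
proof -
  have "U \<epsilon> a \<mu> (bracket (case_sum L I i) (case_sum L I j))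
      = bracket (U \<epsilon> a \<mu> (case_sum L I i)) (U \<epsilon> a \<mu> (case_sum L I j))" for i j
    using assms
    by (cases i; cases j)
      ((auto simp: U_L U_I bracket_L_L bracket_L_I bracket_I_L bracket_I_I bracket_scale_left
        bracket_scale_right linear_scale[OF U_linear] linear_zero[OF U_linear]
        distrib_left; auto simp: power_int_add algebra_simps)+)
  then have "U \<epsilon> a \<mu> (bracket x y) = bracket (U \<epsilon> a \<mu> x) (U \<epsilon> a \<mu> y)" for x y
    using basis.preserves_bracket[OF lie_algebra_axioms lie_algebra_axioms U_linear] by blast
  then show ?thesis
    using U_inverse[OF assms] o_bij U_linear by (auto simp: lie_aut_iff)
qed

end

section \<open>Classification of the automorphisms of \<open>W\<close>\<close>

text \<open>The hypothesis leaves out the diagonal \<open>m = n\<close>, which is recovered by splitting off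
  an auxiliary \<open>k\<close> outside \<open>{0, n, 2 n}\<close>. The same happens in the additive version below.\<close>

lemma off_diagonal_multiplicative:
  fixes c :: "int \<Rightarrow> 'a::field"
  assumes ne: "\<And>n. c n \<noteq> 0" and off: "\<And>m n. m \<noteq> n \<Longrightarrow> c m * c n = c (m + n)"
  shows "c n = c 1 powi n"
proof -
  have "c n * c n = c (n + n)" for n
  proof -
    define k where "k = 3 * \<bar>n\<bar> + 1"
    have k: "k \<noteq> 0" "k \<noteq> n" "k \<noteq> n + n"
      by (auto simp: k_def)
    have "c n * c n * c k = c n * c (n + k)"
      using off[of n k] k by (simp add: mult.assoc)
    also have "\<dots> = c (n + n) * c k"
      using off[of n "n + k"] off[of "n + n" k] k by (simp add: add.assoc)
    finally show ?thesis
      using ne by simp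
  qed
  with off have mult: "c m * c n = c (m + n)" for m n
    by (cases "m = n") auto
  have c0: "c 0 = 1"
    using mult[of 0 0] ne[of 0] by simp
  have pos: "c (int n) = c 1 ^ n" for n
    by (induction n) (simp_all add: c0 flip: mult)
  have neg: "c (- int n) * c 1 ^ n = 1" for n
    using mult[of "- int n" "int n"] pos[of n] c0 by simp
  show ?thesis
    using pos[of "nat n"] neg[of "nat (- n)"] ne[of 1]
    by (cases "n \<ge> 0") (simp_all add: power_int_def field_simps)
qed

lemma off_diagonal_additive:
  fixes e :: "int \<Rightarrow> 'a::ring_1"
  assumes off: "\<And>m n. m \<noteq> n \<Longrightarrow> e m + e n = e (m + n)"
  shows "e n = of_int n * e 1"
proof -
  have "e n + e n = e (n + n)" for n
  proof -
    define k where "k = 3 * \<bar>n\<bar> + 1"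
    have k: "k \<noteq> 0" "k \<noteq> n" "k \<noteq> n + n"
      by (auto simp: k_def)
    have "e n + e n + e k = e n + e (n + k)"
      using off[of n k] k by (simp add: add.assoc)
    also have "\<dots> = e (n + n) + e k"
      using off[of n "n + k"] off[of "n + n" k] k by (simp add: add.assoc)
    finally show ?thesis
      by simp
  qed
  with off have add: "e m + e n = e (m + n)" for m n
    by (cases "m = n") auto
  have e0: "e 0 = 0"
    using add[of 0 0] by simp
  have pos: "e (int n) = of_nat n * e 1" for n
    by (induction n) (simp_all add: e0 distrib_right flip: add)
  have neg: "e (- int n) + of_nat n * e 1 = 0" for n
    using add[of "- int n" "int n"] pos[of n] e0 by simp
  show ?thesis
    using pos[of "nat n"] neg[of "nat (- n)"] by (cases "n \<ge> 0") simp_all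
qed

context W_algebra
begin

section \<open>Leading terms, and the images of the L_n modulo the ideal\<close>

lemma cL_bracket_single:
  assumes "\<And>i. i \<noteq> n \<Longrightarrow> cL x i = 0"
  shows "cL (bracket x y) k = of_int (2 * n - k) * cL x n * cL y (k - n)"
  using cL_bracket[of "{n}" x y k] assms by simp

text \<open>Degrees at most n and at most m add up to k >= n + m only if both are maximal, so the
  term i = n alone can survive. For k > n + m both sides are 0, so the same formula also gives
  vanishing above the top degree.\<close>

lemma cL_bracket_top:
  assumes "\<And>i. i > n \<Longrightarrow> cL x i = 0" "\<And>i. i > m \<Longrightarrow> cL y i = 0" "k \<ge> n + m"
  shows "cL (bracket x y) k = of_int (2 * n - k) * cL x n * cL y (k - n)"
proof -
  define S where "S = insert n {i. cL x i \<noteq> 0}"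
  have fin: "finite S"
    by (simp add: S_def finite_cL)
  have "cL (bracket x y) k = (\<Sum>i\<in>S. of_int (2 * i - k) * cL x i * cL y (k - i))"
    using fin by (intro cL_bracket) (auto simp: S_def)
  also have "\<dots> = (\<Sum>i\<in>{n}. of_int (2 * i - k) * cL x i * cL y (k - i))"
  proof (rule sum.mono_neutral_right[OF fin], goal_cases)
    case 2
    have "cL x i = 0 \<or> cL y (k - i) = 0" if "i \<noteq> n" for i
      using assms(1)[of i] assms(2)[of "k - i"] assms(3) that by (cases "i > n") auto
    then show ?case
      by auto
  qed (simp add: S_def)
  finally show ?thesis
    by simp
qed

lemma top_degree:
  assumes "x \<notin> J"
  obtains n where "cL x n \<noteq> 0" "\<And>i. i > n \<Longrightarrow> cL x i = 0"
proof (rule that[of "Max {i. cL x i \<noteq> 0}"])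
  show "cL x (Max {i. cL x i \<noteq> 0}) \<noteq> 0"
    using Max_in[OF finite_cL[of x]] assms by (auto simp: J_def)
  show "cL x i = 0" if "i > Max {i. cL x i \<noteq> 0}" for i
    using Max_ge[OF finite_cL, of i x] that by force
qed

lemma J_iff_ad_square: "x \<in> J \<longleftrightarrow> (\<forall>y. bracket x (bracket x y) = 0)"
proof
  assume "\<forall>y. bracket x (bracket x y) = 0"
  show "x \<in> J"
  proof (rule ccontr)
    assume "x \<notin> J"
    then obtain n where n: "cL x n \<noteq> 0" "\<And>i. i > n \<Longrightarrow> cL x i = 0"
      using top_degree by blast
    \<comment> \<open>The top coefficient of (ad x)^2 L_m carries the factors n - m and n - (n + m)
      = -m; this choice of m avoids both 0 and n.\<close>
    define m where "m = \<bar>n\<bar> + 1"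
    have 1: "cL (bracket x (L m)) k = of_int (2 * n - k) * cL x n * cL (L m) (k - n)"
      if "k \<ge> n + m" for k
      by (rule cL_bracket_top[of n x m]) (use n that in auto)
    have top: "cL (bracket x (L m)) i = 0" if "i > n + m" for i
      using 1[of i] that by simp
    have "cL (bracket x (bracket x (L m))) (2 * n + m) = of_int (- m) * cL x n * cL (bracket x (L m)) (n + m)"
      by (subst cL_bracket_top[of n x "n + m"]) (use n top in \<open>auto simp: algebra_simps\<close>)
    also have "\<dots> \<noteq> 0"
    proof -
      have "m \<noteq> 0" "m \<noteq> n"
        by (auto simp: m_def)
      then show ?thesis
        using n(1) by (simp add: 1)
    qed
    finally show False
      using \<open>\<forall>y. bracket x (bracket x y) = 0\<close> by simp
  qed
qed (simp add: bracket_J_J bracket_J_left)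

lemma aut_surj:
  assumes "f \<in> carrier AutW"
  obtains x where "y = f x"
  using bij_is_surj[OF aut_bij[OF assms]] by blast

lemma aut_J_iff:
  assumes f: "f \<in> carrier AutW"
  shows "f x \<in> J \<longleftrightarrow> x \<in> J"
proof -
  have "bracket (f x) (bracket (f x) (f y)) = 0 \<longleftrightarrow> bracket x (bracket x y) = 0" for y
    using inj_eq[OF bij_is_inj[OF aut_bij[OF f]], of "bracket x (bracket x y)" 0]
    by (simp add: aut_bracket[OF f] linear_zero[OF aut_linear[OF f]])
  then show ?thesis
    unfolding J_iff_ad_square using aut_surj[OF f] by metis
qed

text \<open>If \<open>f L\<^sub>0\<close> had top degree \<open>d > 0\<close>, bracketing with it would raise top degrees other
  than \<open>d\<close>; its eigenvectors \<open>f L\<^sub>k\<close> would then all have top degree \<open>d\<close>, and \<open>f\<close> would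
  not be onto.\<close>

lemma aut_L0_top:
  assumes f: "f \<in> carrier AutW" and "n > 0"
  shows "cL (f (L 0)) n = 0"
proof -
  obtain d where d: "cL (f (L 0)) d \<noteq> 0" "\<And>i. i > d \<Longrightarrow> cL (f (L 0)) i = 0"
    using top_degree[of "f (L 0)"] L_notin_J aut_J_iff[OF f] by metis
  have "d \<le> 0"
  proof (rule ccontr)
    assume "\<not> d \<le> 0"
    have bound: "cL (f (L k)) i = 0" if "i > d" for k i
    proof -
      obtain m where m: "cL (f (L k)) m \<noteq> 0" "\<And>i. i > m \<Longrightarrow> cL (f (L k)) i = 0"
        using top_degree[of "f (L k)"] L_notin_J aut_J_iff[OF f] by metis
      have "bracket (f (L 0)) (f (L k)) = of_int (- k) *s f (L k)"
        using bracket_L_L[of 0 k] by (simp add: linear_scale[OF aut_linear[OF f]]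
            linear_neg[OF aut_linear[OF f]] flip: aut_bracket[OF f])
      then have "cL (bracket (f (L 0)) (f (L k))) (d + m) = 0"
        using m(2)[of "d + m"] \<open>\<not> d \<le> 0\<close> by simp
      moreover have "cL (bracket (f (L 0)) (f (L k))) (d + m)
          = of_int (2 * d - (d + m)) * cL (f (L 0)) d * cL (f (L k)) (d + m - d)"
        by (rule cL_bracket_top[of d _ m]) (use d m in auto)
      ultimately have "d = m"
        using d(1) m(1) by simp
      then show ?thesis
        using m(2) that by simp
    qed
    have "cL (f y) i = 0" if "i > d" for y i
    proof (induction y rule: W_induct)
      case (L n)
      then show ?case
        using bound that .
    next
      case (I n)
      then show ?case
        using aut_J_iff[OF f, of "I n"] by (simp add: J_def)
    qed (simp_all add: linear_add[OF aut_linear[OF f]] linear_scale[OF aut_linear[OF f]])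
    from this[of "d + 1"] show False
      using aut_surj[OF f, of "L (d + 1)"] cL_simps(3)[of "d + 1" "d + 1"]
      by (metis less_add_one zero_neq_one)
  qed
  then show ?thesis
    using d(2) \<open>n > 0\<close> by simp
qed

text \<open>Negative degrees reduce to positive ones by composing with the reflection L_n ->
  -L_{-n}.\<close>

lemma aut_L0:
  assumes f: "f \<in> carrier AutW" and "n \<noteq> 0"
  shows "cL (f (L 0)) n = 0"
proof (cases "n > 0")
  case False
  have flip: "cL (U (- 1) 1 1 y) k = - cL y (- k)" for y k
    by (induction y rule: W_induct)
      (auto simp: U_L U_I linear_add[OF U_linear] linear_scale[OF U_linear])
  have "U (- 1) 1 1 \<circ> f \<in> carrier AutW"
    by (intro aut_comp U_aut f) auto
  from aut_L0_top[OF this, of "- n"] False \<open>n \<noteq> 0\<close> show ?thesis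
    by (simp add: flip)
qed (rule aut_L0_top[OF f])

text \<open>Modulo \<open>J\<close>, f(L_0) is a multiple \<alpha> L_0. Comparing degree k in
  [f(L_0), f(L_m)] = -m f(L_m) gives -k \<alpha> = -m wherever f(L_m) has a nonzero
  coefficient.\<close>

lemma aut_L_support:
  assumes f: "f \<in> carrier AutW" and "cL (f (L m)) k \<noteq> 0"
  shows "cL (f (L 0)) 0 * of_int k = of_int m"
proof -
  have "bracket (f (L 0)) (f (L m)) = of_int (- m) *s f (L m)"
    using bracket_L_L[of 0 m] by (simp add: linear_scale[OF aut_linear[OF f]]
        linear_neg[OF aut_linear[OF f]] flip: aut_bracket[OF f])
  then show ?thesis
    using cL_bracket_single[of 0 "f (L 0)" "f (L m)" k] aut_L0[OF f] assms(2) by simp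
qed

lemma aut_L_notin_J:
  assumes f: "f \<in> carrier AutW"
  obtains k where "cL (f (L m)) k \<noteq> 0"
  using aut_J_iff[OF f, of "L m"] L_notin_J by (auto simp: J_def)

text \<open>For m = 1, \<open>aut_L_support\<close> yields integers k and l with \<alpha> k = 1 for
  \<open>f\<close> and \<beta> l = 1 for its inverse. Applying \<open>f\<close> to the image of L_0
  under the inverse gives \<alpha> \<beta> = 1, hence k l = 1 and k is a sign.\<close>

lemma aut_L0_sign:
  assumes f: "f \<in> carrier AutW"
  obtains \<epsilon> where "\<epsilon> \<in> {1, -1}" "cL (f (L 0)) 0 = of_int \<epsilon>"
proof -
  define g where "g = inv_into UNIV f"
  have g: "g \<in> carrier AutW"
    using aut_inv[OF f] by (simp add: g_def)
  obtain k where k: "cL (f (L 0)) 0 * of_int k = 1"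
    using aut_L_notin_J[OF f, of 1] aut_L_support[OF f, of 1] by auto
  obtain l where l: "cL (g (L 0)) 0 * of_int l = 1"
    using aut_L_notin_J[OF g, of 1] aut_L_support[OF g, of 1] by auto
  define \<beta> where "\<beta> = cL (g (L 0)) 0"
  have "g (L 0) - \<beta> *s L 0 \<in> J"
    using aut_L0[OF g] by (auto simp: J_def \<beta>_def)
  then have "f (g (L 0)) - \<beta> *s f (L 0) \<in> J"
    using aut_J_iff[OF f, of "g (L 0) - \<beta> *s L 0"]
    by (simp add: linear_diff[OF aut_linear[OF f]] linear_scale[OF aut_linear[OF f]])
  moreover have "f (g (L 0)) = L 0"
    by (simp add: g_def bij_is_surj[OF aut_bij[OF f]] surj_f_inv_f)
  ultimately have "L 0 - \<beta> *s f (L 0) \<in> J"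
    by (rule back_subst[where P = "\<lambda>x. x - \<beta> *s f (L 0) \<in> J"])
  then have "cL (L 0 - \<beta> *s f (L 0)) 0 = 0"
    unfolding J_def by blast
  then have ab: "\<beta> * cL (f (L 0)) 0 = 1"
    by simp
  have "of_int (k * l) = (\<beta> * cL (f (L 0)) 0) * of_int (k * l)"
    by (simp add: ab)
  also have "\<dots> = (cL (f (L 0)) 0 * of_int k) * (\<beta> * of_int l)"
    by simp
  also have "\<dots> = 1"
    using k l by (simp add: \<beta>_def)
  finally have "k * l = 1"
    using of_int_eq_1_iff by blast
  then have "k \<in> {1, -1}"
    by (auto simp: zmult_eq_1_iff)
  with k show thesis
    by (intro that[of k]) (auto simp: minus_equation_iff[of _ 1])
qed

text \<open>With \<alpha> = 1, \<open>aut_L_support\<close> makes \<open>f\<close> diagonal on the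
  L_n modulo \<open>J\<close>; the bracket relations then make its diagonal entries a character of
  the integers.\<close>

lemma aut_normalized_L:
  assumes f: "f \<in> carrier AutW" and one: "cL (f (L 0)) 0 = 1"
  obtains a where "a \<noteq> 0" "\<And>n. f (L n) - (a powi n) *s L n \<in> J"
proof -
  have supp: "cL (f (L m)) k = 0" if "k \<noteq> m" for m k
    using aut_L_support[OF f, of m k] that one by auto
  define c where "c n = cL (f (L n)) n" for n
  have ne: "c n \<noteq> 0" for n
  proof -
    obtain k where k: "cL (f (L n)) k \<noteq> 0"
      by (rule aut_L_notin_J[OF f])
    with supp[of k n] have "k = n"
      by blast
    with k show ?thesis
      by (simp add: c_def)
  qed
  \<comment> \<open>The factor m - n has to be cancelled, hence the restriction to m different from
    n.\<close>
  have "c m * c n = c (m + n)" if "m \<noteq> n" for m n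
  proof -
    have "(of_int m - of_int n) * (c m * c n) = cL (bracket (f (L m)) (f (L n))) (m + n)"
      using cL_bracket_single[of m "f (L m)" "f (L n)" "m + n"] supp by (simp add: c_def)
    also have "\<dots> = of_int (m - n) * c (m + n)"
      using linear_scale[OF aut_linear[OF f], of "of_int (m - n)" "L (m + n)"]
      by (simp only: bracket_L_L c_def cL_simps flip: aut_bracket[OF f])
    finally have "(of_int m - of_int n) * (c m * c n) = (of_int m - of_int n) * c (m + n)"
      by (simp only: of_int_diff)
    moreover have "(of_int m - of_int n :: complex) \<noteq> 0"
      using that by simp
    ultimately show ?thesis
      by (metis mult_cancel_left)
  qed
  then have powi: "c n = c 1 powi n" for n
    using off_diagonal_multiplicative[of c] ne by blast
  have "f (L n) - (c 1 powi n) *s L n \<in> J" for n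
    unfolding powi[symmetric] using supp by (auto simp: J_def c_def)
  then show thesis
    using that[of "c 1"] ne by blast
qed

text \<open>As \<open>J\<close> is abelian, f(L_m) can be replaced by L_m in brackets with f(I_n).
  Then m = 0 shows f(I_n) to be an eigenvector of ad L_0, so a multiple of I_n, and [L_n, I_0] = n
  I_n makes the factor independent of n.\<close>

lemma aut_normalized_I:
  assumes f: "f \<in> carrier AutW" and L: "\<And>n. f (L n) - L n \<in> J"
  obtains \<mu> where "\<mu> \<noteq> 0" "\<And>n. f (I n) = \<mu> *s I n"
proof -
  have fJ: "f (I n) \<in> J" for n
    using aut_J_iff[OF f] by simp
  have br: "bracket (L m) (f (I n)) = of_int (m - n) *s f (I (m + n))" for m n
  proof -
    have "bracket (f (L m)) (f (I n)) = of_int (m - n) *s f (I (m + n))"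
      using linear_scale[OF aut_linear[OF f], of "of_int (m - n)" "I (m + n)"]
      by (simp only: bracket_L_I flip: aut_bracket[OF f])
    moreover have "bracket (f (L m) - L m) (f (I n)) = 0"
      by (rule bracket_J_J[OF L fJ])
    ultimately show ?thesis
      by (simp add: bracket_diff_left)
  qed
  have supp: "cI (f (I n)) k = 0" if "k \<noteq> n" for n k
    using arg_cong[OF br[of 0 n], of "\<lambda>x. cI x k"] that by (simp add: cI_bracket_L)
  define \<mu> where "\<mu> n = cI (f (I n)) n" for n
  have fI: "f (I n) = \<mu> n *s I n" for n
    using J_expansion[OF fJ, of "{n}" n] supp by (simp add: \<mu>_def)
  have "\<mu> n = \<mu> 0" for n
    using arg_cong[OF br[of n 0], of "\<lambda>x. cI x n"]
    by (cases "n = 0") (simp_all add: fI bracket_scale_right bracket_L_I)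
  with fI have "f (I n) = \<mu> 0 *s I n" for n
    by simp
  moreover have "\<mu> 0 \<noteq> 0"
  proof
    assume "\<mu> 0 = 0"
    then have "f (I 0) = f 0"
      by (simp add: fI linear_zero[OF aut_linear[OF f]])
    then have "I 0 = 0"
      by (rule injD[OF bij_is_inj[OF aut_bij[OF f]]])
    then show False
      using cI_simps(4)[of 0 0] by (simp del: cI_simps(4))
  qed
  ultimately show thesis
    using that by blast
qed

text \<open>Such an automorphism differs from \<open>id\<close> by a derivation \<open>L\<^sub>n \<mapsto> \<Sum>\<^sub>k d n k I\<^sub>k\<close>
  into \<open>J\<close>. Evaluating the derivation rule at \<open>[L\<^sub>0, L\<^sub>n]\<close> expresses \<open>d n k\<close> for \<open>k \<noteq> n\<close>
  through \<open>d 0\<close>; the diagonal \<open>d n n\<close> is additive in \<open>n\<close>. Hence the derivation is inner.\<close>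

lemma aut_unipotent:
  assumes f: "f \<in> carrier AutW" and L: "\<And>n. f (L n) - L n \<in> J" and I: "\<And>n. f (I n) = I n"
  obtains x where "x \<in> J" "f = E x"
proof -
  define d where "d n k = cI (f (L n)) k" for n k
  have der: "of_int (m - n) * d (m + n) k
      = of_int (2 * m - k) * d n (k - m) - of_int (2 * n - k) * d m (k - n)" for m n k
  proof -
    define u v where "u = f (L m) - L m" and "v = f (L n) - L n"
    have uv: "f (L m) = L m + u" "f (L n) = L n + v" "bracket u v = 0"
      using bracket_J_J[OF L L] by (simp_all add: u_def v_def)
    have "of_int (m - n) *s f (L (m + n)) = bracket (f (L m)) (f (L n))"
      using linear_scale[OF aut_linear[OF f], of "of_int (m - n)" "L (m + n)"]
      by (simp only: bracket_L_L flip: aut_bracket[OF f])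
    also have "\<dots> = bracket (L m) (L n) + bracket (L m) v - bracket (L n) u"
      unfolding uv(1,2) using bracket_sym[of u "L n"] uv(3)
      by (simp add: bracket_add_left bracket_add_right)
    finally have "cI (of_int (m - n) *s f (L (m + n))) k
        = cI (bracket (L m) (L n) + bracket (L m) v - bracket (L n) u) k"
      by (rule arg_cong)
    then show ?thesis
      by (simp add: cI_bracket_L d_def u_def v_def)
  qed
  have off: "of_int (k - n) * d n k = of_int (k - 2 * n) * d 0 (k - n)" for n k
    using der[of 0 n k] by (simp add: algebra_simps)
  have "d m m + d n n = d (m + n) (m + n)" if "m \<noteq> n" for m n
  proof -
    have "(of_int m - of_int n) * d (m + n) (m + n) = (of_int m - of_int n) * (d m m + d n n)"
      using der[of m n "m + n"] by (simp add: algebra_simps)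
    moreover have "(of_int m - of_int n :: complex) \<noteq> 0"
      using that by simp
    ultimately show ?thesis
      by (metis mult_cancel_left)
  qed
  then have diag: "d n n = of_int n * d 1 1" for n
    by (rule off_diagonal_additive[where e = "\<lambda>n. d n n"])
  \<comment> \<open>[x, L_n] has coefficient (k - 2 n) c(k - n) at I_k. For k different from n,
    \<open>off\<close> dictates the quotient; for k = n the coefficient is -n c(0) and must equal n
    \<open>d 1 1\<close>, which dictates c(0).\<close>
  define c where "c k = (if k = 0 then - d 1 1 else d 0 k / of_int k)" for k
  define S where "S = insert 0 {k. d 0 k \<noteq> 0}"
  define x where "x = (\<Sum>k\<in>S. c k *s I k)"
  have "finite S"
    using finite_cI[of "f (L 0)"] by (simp add: S_def d_def)
  then have cx: "cI x k = c k" for k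
    by (auto simp: x_def if_distrib[of "\<lambda>u. _ * u"] S_def c_def cong: if_cong)
  have xJ: "x \<in> J"
    by (simp add: x_def)
  have fL: "f (L n) = E x (L n)" for n
  proof (rule W_eqI)
    show "cL (f (L n)) k = cL (E x (L n)) k" for k
      using L[of n] bracket_J_left[OF xJ, of "L n"] by (simp add: J_def E_def)
    show "cI (f (L n)) k = cI (E x (L n)) k" for k
    proof -
      have "cI (E x (L n)) k = of_int (k - 2 * n) * c (k - n)"
        using bracket_sym[of x "L n"] by (simp add: E_def cI_bracket_L cx algebra_simps)
      moreover have "d n k = of_int (k - 2 * n) * c (k - n)"
        using off[of k n] diag[of n] by (auto simp: c_def field_simps)
      ultimately show ?thesis
        by (simp add: d_def)
    qed
  qed
  have "f = E x"
    by (rule W_linear_ext[OF aut_linear[OF f] aut_linear[OF E_aut[OF xJ]] fL])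
      (simp add: I E_def bracket_J_J xJ)
  with xJ show thesis
    by (rule that)
qed

text \<open>Right factors remove the sign, then \<open>a\<close>, then \<mu>; each normalization
  presupposes the preceding ones. What remains is unipotent and hence of the form
  \<open>E x\<close>.\<close>

theorem aut_classification:
  assumes f: "f \<in> carrier AutW"
  obtains x \<epsilon> a \<mu> where "x \<in> J" "\<epsilon> \<in> {1, -1}" "a \<noteq> 0" "\<mu> \<noteq> 0" "f = E x \<circ> U \<epsilon> a \<mu>"
proof -
  obtain \<epsilon> where \<epsilon>: "\<epsilon> \<in> {1, -1}" "cL (f (L 0)) 0 = of_int \<epsilon>"
    using aut_L0_sign[OF f] .
  define g where "g = f \<circ> U \<epsilon> 1 1"
  have g: "g \<in> carrier AutW"
    unfolding g_def by (intro aut_comp f U_aut) (use \<epsilon> in auto)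
  have "cL (g (L 0)) 0 = 1"
    using \<epsilon> by (auto simp: g_def U_L linear_scale[OF aut_linear[OF f]] linear_neg[OF aut_linear[OF f]])
  then obtain a where a: "a \<noteq> 0" "\<And>n. g (L n) - (a powi n) *s L n \<in> J"
    using aut_normalized_L[OF g] by blast
  define h where "h = g \<circ> U 1 (inverse a) 1"
  have h: "h \<in> carrier AutW"
    unfolding h_def by (intro aut_comp g U_aut) (use a in auto)
  have hL: "h (L n) - L n \<in> J" for n
  proof -
    have "h (L n) - L n = inverse (a powi n) *s (g (L n) - (a powi n) *s L n)"
      using a(1) by (simp add: h_def U_L linear_scale[OF aut_linear[OF g]] scale_right_diff_distrib
          power_int_inverse)
    then show ?thesis
      using a(2) by simp
  qed
  obtain \<mu> where \<mu>: "\<mu> \<noteq> 0" "\<And>n. h (I n) = \<mu> *s I n"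
    using aut_normalized_I[OF h hL] by blast
  define k where "k = h \<circ> U 1 1 (inverse \<mu>)"
  have k: "k \<in> carrier AutW"
    unfolding k_def by (intro aut_comp h U_aut) (use \<mu> in auto)
  have "k (L n) - L n \<in> J" "k (I n) = I n" for n
    using hL \<mu> by (simp_all add: k_def U_L U_I linear_scale[OF aut_linear[OF h]])
  then obtain x where x: "x \<in> J" "k = E x"
    using aut_unipotent[OF k] by blast
  have "k = f \<circ> U \<epsilon> (inverse a) (inverse \<mu>)"
    using a(1) by (simp add: k_def h_def g_def U_comp o_assoc[symmetric])
  \<comment> \<open>Inverting a map \<open>U\<close> twists its torus parameter by the sign, hence
    the exponent \<open>- \<epsilon>\<close>.\<close>
  then have "f = E x \<circ> U \<epsilon> (inverse a powi - \<epsilon>) \<mu>"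
    using U_inverse(1)[OF \<epsilon>(1), of "inverse a" "inverse \<mu>"] a(1) \<mu>(1) x(2)
    by (metis comp_assoc comp_id inverse_inverse_eq inverse_zero nonzero_imp_inverse_nonzero)
  then show thesis
    using that[OF x(1) \<epsilon>(1), of "inverse a powi - \<epsilon>" \<mu>] a(1) \<mu>(1) by simp
qed

text \<open>\<open>E x\<close> is the identity modulo \<open>J\<close> and on \<open>J\<close>. So
  the sign and \<open>a\<close> can be read off the L-parts of the images of L_0 and L_1, and \<mu>
  off the image of I_0; cancelling the surjective \<open>U\<close> then leaves
  \<open>E_inj\<close>.\<close>

lemma E_U_inj:
  assumes "x \<in> J" "x' \<in> J" "\<epsilon> \<in> {1, -1}" "a \<noteq> 0" "\<mu> \<noteq> 0" and eq: "E x \<circ> U \<epsilon> a \<mu> = E x' \<circ> U \<epsilon>' a' \<mu>'"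
  shows "x = x'" "\<epsilon> = \<epsilon>'" "a = a'" "\<mu> = \<mu>'"
proof -
  have E: "cL (E z y) n = cL y n" if "z \<in> J" for z y n
    using bracket_J_left[OF that, of y] by (simp add: E_def J_def)
  have UL: "cL (U \<epsilon> a \<mu> (L n)) k = cL (U \<epsilon>' a' \<mu>' (L n)) k" for n k
    using arg_cong[OF fun_cong[OF eq, of "L n"], of "\<lambda>y. cL y k"] E assms(1,2) by simp
  from UL[of 0 0] show \<epsilon>: "\<epsilon> = \<epsilon>'"
    by (simp add: U_L)
  from UL[of 1 \<epsilon>] show a: "a = a'"
    using assms(3) by (auto simp: U_L simp flip: \<epsilon>)
  have "E z (c *s I 0) = c *s I 0" if "z \<in> J" for z c
    using that by (simp add: E_def bracket_J_J)
  then have "\<mu> *s I 0 = \<mu>' *s I 0"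
    using fun_cong[OF eq, of "I 0"] assms(1,2) by (simp add: U_I)
  from arg_cong[OF this, of "\<lambda>y. cI y 0"] show \<mu>: "\<mu> = \<mu>'"
    by simp
  have "surj (U \<epsilon> a \<mu>)"
    using bij_is_surj[OF aut_bij[OF U_aut]] assms(3-5) by blast
  then have "E x = E x'"
    using eq unfolding \<epsilon>[symmetric] a[symmetric] \<mu>[symmetric] by (metis surj_fun_eq)
  then show "x = x'"
    by (rule E_inj)
qed

end

section \<open>Semidirect products inside a group\<close>

lemma acts_by_conj_conj_action:
  assumes "\<And>h n. h \<in> carrier H \<Longrightarrow> n \<in> carrier N \<Longrightarrow>
    \<kappa> h \<otimes>\<^bsub>G\<^esub> \<iota> n \<otimes>\<^bsub>G\<^esub> inv\<^bsub>G\<^esub> (\<kappa> h) \<in> \<iota> ` carrier N"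
  shows "acts_by_conj G N H \<iota> \<kappa> (conj_action G N \<iota> \<kappa>)"
  using assms by (simp add: acts_by_conj_def conj_action_def inv_into_into f_inv_into_f)

text \<open>The inverse of \<open>\<kappa> h\<close> in the conjugation cancels against the factor
  \<open>\<kappa> h\<close> that follows it.\<close>

lemma semidirect_hom:
  assumes "group G" and \<iota>: "\<iota> \<in> hom N G" and \<kappa>: "\<kappa> \<in> hom H G" and act: "acts_by_conj G N H \<iota> \<kappa> \<phi>"
  shows "(\<lambda>(n, h). \<iota> n \<otimes>\<^bsub>G\<^esub> \<kappa> h) \<in> hom (semidirect N H \<phi>) G"
proof (rule homI)
  interpret group G by fact
  note closed = hom_in_carrier[OF \<iota>] hom_in_carrier[OF \<kappa>]
  show "(case x of (n, h) \<Rightarrow> \<iota> n \<otimes>\<^bsub>G\<^esub> \<kappa> h) \<in> carrier G" if "x \<in> carrier (semidirect N H \<phi>)" for x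
    using that closed by (auto simp: semidirect_def)
  fix x y
  assume "x \<in> carrier (semidirect N H \<phi>)" "y \<in> carrier (semidirect N H \<phi>)"
  then obtain n h n' h' where xy: "x = (n, h)" "y = (n', h')"
    and n: "n \<in> carrier N" "n' \<in> carrier N" and h: "h \<in> carrier H" "h' \<in> carrier H"
    by (auto simp: semidirect_def)
  have "\<phi> h n' \<in> carrier N" "\<iota> (\<phi> h n') = \<kappa> h \<otimes>\<^bsub>G\<^esub> \<iota> n' \<otimes>\<^bsub>G\<^esub> inv\<^bsub>G\<^esub> (\<kappa> h)"
    using act n h by (auto simp: acts_by_conj_def)
  then have "\<iota> (n \<otimes>\<^bsub>N\<^esub> \<phi> h n') \<otimes>\<^bsub>G\<^esub> \<kappa> (h \<otimes>\<^bsub>H\<^esub> h')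
      = \<iota> n \<otimes>\<^bsub>G\<^esub> (\<kappa> h \<otimes>\<^bsub>G\<^esub> (\<iota> n' \<otimes>\<^bsub>G\<^esub> (inv\<^bsub>G\<^esub> (\<kappa> h) \<otimes>\<^bsub>G\<^esub> (\<kappa> h \<otimes>\<^bsub>G\<^esub> \<kappa> h'))))"
    using n h by (simp add: hom_mult[OF \<iota>] hom_mult[OF \<kappa>] closed m_assoc)
  also have "inv\<^bsub>G\<^esub> (\<kappa> h) \<otimes>\<^bsub>G\<^esub> (\<kappa> h \<otimes>\<^bsub>G\<^esub> \<kappa> h') = \<kappa> h'"
    using h closed by (simp flip: m_assoc)
  finally show "(case x \<otimes>\<^bsub>semidirect N H \<phi>\<^esub> y of (n, h) \<Rightarrow> \<iota> n \<otimes>\<^bsub>G\<^esub> \<kappa> h)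
      = (case x of (n, h) \<Rightarrow> \<iota> n \<otimes>\<^bsub>G\<^esub> \<kappa> h) \<otimes>\<^bsub>G\<^esub> (case y of (n, h) \<Rightarrow> \<iota> n \<otimes>\<^bsub>G\<^esub> \<kappa> h)"
    using n h closed by (simp add: xy semidirect_def m_assoc)
qed

lemma semidirect_mult_closed:
  assumes "acts_by_conj G N H \<iota> \<kappa> \<phi>"
    and "\<And>n n'. n \<in> carrier N \<Longrightarrow> n' \<in> carrier N \<Longrightarrow> n \<otimes>\<^bsub>N\<^esub> n' \<in> carrier N"
    and "\<And>h h'. h \<in> carrier H \<Longrightarrow> h' \<in> carrier H \<Longrightarrow> h \<otimes>\<^bsub>H\<^esub> h' \<in> carrier H"
    and "x \<in> carrier (semidirect N H \<phi>)" "y \<in> carrier (semidirect N H \<phi>)"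
  shows "x \<otimes>\<^bsub>semidirect N H \<phi>\<^esub> y \<in> carrier (semidirect N H \<phi>)"
  using assms by (auto simp: semidirect_def acts_by_conj_def)

lemma iso_subgroup:
  "h \<in> hom G H \<Longrightarrow> inj_on h (carrier G) \<Longrightarrow> h ` carrier G = S \<Longrightarrow> h \<in> iso G (H\<lparr>carrier := S\<rparr>)"
  by (auto simp: iso_def hom_def bij_betw_def)

text \<open>Phrased with bare closure because \<open>Cinf_K\<close> enters as a record whose closure
  comes from \<open>semidirect_mult_closed\<close>.\<close>

lemma iso_inv_into:
  assumes h: "h \<in> iso G H" and closed: "\<And>x y. x \<in> carrier G \<Longrightarrow> y \<in> carrier G \<Longrightarrow> x \<otimes>\<^bsub>G\<^esub> y \<in> carrier G"
  shows "inv_into (carrier G) h \<in> iso H G"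
proof -
  have hom: "h \<in> hom G H" and bij: "bij_betw h (carrier G) (carrier H)"
    using h by (auto simp: iso_def)
  have "inv_into (carrier G) h (x \<otimes>\<^bsub>H\<^esub> y) = inv_into (carrier G) h x \<otimes>\<^bsub>G\<^esub> inv_into (carrier G) h y"
    if "x \<in> carrier H" "y \<in> carrier H" for x y
  proof -
    obtain u v where "u \<in> carrier G" "v \<in> carrier G" "x = h u" "y = h v"
      using \<open>x \<in> carrier H\<close> \<open>y \<in> carrier H\<close> bij unfolding bij_betw_def by blast
    then show ?thesis
      using closed bij by (simp add: bij_betw_inv_into_left flip: hom_mult[OF hom])
  qed
  then show ?thesis
    using bij_betw_inv_into[OF bij] by (auto simp: iso_def hom_def bij_betw_apply)
qed


section \<open>The factors of \<open>Aut(W)\<close>\<close>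

lemma Z2_simps [simp]: "carrier Z2 = {1, -1}" "x \<otimes>\<^bsub>Z2\<^esub> y = x * y"
  by (simp_all add: Z2_def)

lemma Cstar_simps [simp]: "carrier Cstar = UNIV - {0}" "x \<otimes>\<^bsub>Cstar\<^esub> y = x * y"
  by (simp_all add: Cstar_def)

lemma Cinf_simps [simp]:
  "a \<in> carrier Cinf \<longleftrightarrow> finite {i. a i \<noteq> 0}" "a \<otimes>\<^bsub>Cinf\<^esub> b = (\<lambda>i. a i + b i)"
  by (simp_all add: Cinf_def)

lemma Cinf_mult_closed:
  assumes "a \<in> carrier Cinf" "b \<in> carrier Cinf"
  shows "a \<otimes>\<^bsub>Cinf\<^esub> b \<in> carrier Cinf"
  using assms by (auto intro: finite_subset[of _ "{i. a i \<noteq> 0} \<union> {i. b i \<noteq> 0}"])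

context W_algebra
begin

text \<open>Resolves the definite description: a linear map is determined by its values on the
  basis, so uniqueness is automatic and existence is all that has to be supplied.\<close>

lemma sigma_bar_eqI:
  assumes f: "f \<in> carrier AutW"
    and L: "\<And>n. f (L n) = (a powi n * of_int \<epsilon>) *s L (\<epsilon> * n) + (a powi n * lam * of_int n) *s I (\<epsilon> * n)"
    and I: "\<And>n. f (I n) = (a powi n * \<mu>) *s I (\<epsilon> * n)"
  shows "sigma_bar \<epsilon> lam a \<mu> = f"
  unfolding sigma_bar_def
proof (rule the_equality)
  fix g
  assume "g \<in> carrier AutW \<and>
     (\<forall>n. g (L n) = (a powi n * of_int \<epsilon>) *s L (\<epsilon> * n) + (a powi n * lam * of_int n) *s I (\<epsilon> * n)) \<and>
     (\<forall>n. g (I n) = (a powi n * \<mu>) *s I (\<epsilon> * n))"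
  then show "g = f"
    using L I by (intro W_linear_ext[OF aut_linear aut_linear[OF f]]) auto
qed (use assms in blast)

lemma sigma_bar_U:
  "\<epsilon> \<in> {1, -1} \<Longrightarrow> a \<noteq> 0 \<Longrightarrow> \<mu> \<noteq> 0 \<Longrightarrow> sigma_bar \<epsilon> 0 a \<mu> = U \<epsilon> a \<mu>"
  by (rule sigma_bar_eqI) (simp_all add: U_aut U_L U_I)

text \<open>The sign comes from [I_0, L_n] = -n I_n.\<close>

lemma sigma_bar_E: "sigma_bar 1 lam 1 1 = E (- lam *s I 0)"
proof (rule sigma_bar_eqI)
  show "E (- lam *s I 0) \<in> carrier AutW"
    by (rule E_aut) simp
qed (simp_all add: E_def bracket_scale_left bracket_minus_left bracket_I_L bracket_I_I)

lemma exp_ad_J: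
  assumes "x \<in> J"
  shows "exp_loc_nilpotent scale (bracket x) = E x"
proof
  fix y
  have sq: "bracket x (bracket x y) = 0" for y
    using assms by (simp add: bracket_J_J bracket_J_left)
  have vanish: "(bracket x ^^ i) y = 0" if "i \<notin> {0, 1}" for i
  proof -
    have "i = Suc (Suc (i - 2))"
      using that by auto
    then have "(bracket x ^^ i) y = bracket x (bracket x ((bracket x ^^ (i - 2)) y))"
      by (metis comp_apply funpow.simps(2))
    then show ?thesis
      by (simp add: sq)
  qed
  have "exp_loc_nilpotent scale (bracket x) y = (\<Sum>i\<in>{0, 1}. (1 / fact i) *s (bracket x ^^ i) y)"
    unfolding exp_loc_nilpotent_def
  proof (rule sum.mono_neutral_left)
    show "{i. (bracket x ^^ i) y \<noteq> 0} \<subseteq> {0, 1}"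
      using vanish by blast
  qed auto
  then show "exp_loc_nilpotent scale (bracket x) y = E x y"
    by (simp add: E_def)
qed

lemma E_zero: "E 0 = id"
  by (simp add: E_def fun_eq_iff)

lemma inv_E:
  assumes "x \<in> J"
  shows "inv\<^bsub>AutW\<^esub> (E x) = E (- x)"
  using assms by (intro inv_Aut_eq) (simp_all add: E_aut E_comp E_zero)

lemma subgroup_E: "subgroup (E ` J) AutW"
proof (rule group.subgroupI[OF group_Aut])
  show "inv\<^bsub>AutW\<^esub> f \<in> E ` J" if "f \<in> E ` J" for f
    using that by (auto simp: inv_E)
  show "f \<otimes>\<^bsub>AutW\<^esub> g \<in> E ` J" if "f \<in> E ` J" "g \<in> E ` J" for f g
    using that by (auto simp: E_comp)
  show "E ` J \<subseteq> carrier AutW"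
    by (auto simp: E_aut)
  show "E ` J \<noteq> {}"
    using J_closed(2) by blast
qed

text \<open>The generators are the \<open>E (k *s I m)\<close>. By \<open>E_comp\<close>, a finite
  sum in \<open>J\<close> becomes a product of generators.\<close>

lemma ZZ_eq: "\<ZZ> = E ` J"
proof -
  have exp: "exp_loc_nilpotent scale (\<lambda>x. k *s bracket (I m) x) = E (k *s I m)" for k m
    using exp_ad_J[of "k *s I m"] by (simp add: bracket_scale_left[abs_def])
  let ?gens = "{exp_loc_nilpotent scale (\<lambda>x. k *s bracket (I m) x) | k m. True}"
  have "generate AutW ?gens \<subseteq> E ` J"
    by (rule group.generate_subgroup_incl[OF group_Aut _ subgroup_E]) (auto simp: exp)
  moreover have "E x \<in> generate AutW ?gens" if "x \<in> J" for x
  proof -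
    have "E (\<Sum>i\<in>S. c i *s I i) \<in> generate AutW ?gens" if "finite S" for S c
      using that
    proof induction
      case empty
      show ?case
        using generate.one[of AutW ?gens] by (simp only: sum.empty E_zero lie_aut_simps)
    next
      case (insert i S)
      have "E (c i *s I i) \<in> generate AutW ?gens"
        by (rule generate.incl) (use exp in fastforce)
      from generate.eng[OF this insert.IH] show ?case
        using insert.hyps by (simp add: E_comp)
    qed
    from this[OF finite_cI, of "cI x" x] show ?thesis
      using J_expansion[OF that finite_cI, of x] by simp
  qed
  ultimately show ?thesis
    by (auto simp: \<ZZ>_def)
qed

text \<open>By \<open>sigma_bar_E\<close>, \<tt> already lies in \<ZZ>, and it contains the
  identity, so the product is \<ZZ> again.\<close>

lemma ZZ_tt_eq: "\<ZZ> <#>\<^bsub>AutW\<^esub> \<tt> = E ` J"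
proof
  show "\<ZZ> <#>\<^bsub>AutW\<^esub> \<tt> \<subseteq> E ` J"
    by (auto simp: set_mult_def ZZ_eq \<tt>_def sigma_bar_E E_comp)
  have "E 0 \<in> \<tt>"
    unfolding \<tt>_def using sigma_bar_E[of 0, symmetric] by auto
  then show "E ` J \<subseteq> \<ZZ> <#>\<^bsub>AutW\<^esub> \<tt>"
    by (auto simp: set_mult_def ZZ_eq E_zero) (metis comp_id)
qed

section \<open>Finitely supported sequences as elements of the ideal, and the three
  identifications\<close>

definition J_of :: "(int \<Rightarrow> complex) \<Rightarrow> 'a" where
  "J_of a = (\<Sum>i | a i \<noteq> 0. a i *s I i)"

lemma J_of_J [simp]: "J_of a \<in> J"
  by (simp add: J_of_def)

lemma cI_J_of:
  assumes "a \<in> carrier Cinf"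
  shows "cI (J_of a) i = a i"
  using assms by (simp add: J_of_def if_distrib[of "\<lambda>u. _ * u"] cong: if_cong)

lemma J_of_cI: "x \<in> J \<Longrightarrow> J_of (cI x) = x"
  unfolding J_of_def by (rule J_expansion[symmetric]) (auto simp: finite_cI)

lemma J_of_add:
  assumes "a \<in> carrier Cinf" "b \<in> carrier Cinf"
  shows "J_of (a \<otimes>\<^bsub>Cinf\<^esub> b) = J_of a + J_of b"
proof (rule W_eqI)
  show "cL (J_of (a \<otimes>\<^bsub>Cinf\<^esub> b)) n = cL (J_of a + J_of b) n" for n
    using J_of_J unfolding J_def by simp
  show "cI (J_of (a \<otimes>\<^bsub>Cinf\<^esub> b)) n = cI (J_of a + J_of b) n" for n
    using cI_J_of[OF Cinf_mult_closed[OF assms], of n] assms cI_J_of by simp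
qed

lemma J_of_bij: "bij_betw J_of (carrier Cinf) J"
  by (rule bij_betw_byWitness[where f' = cI]) (auto simp: cI_J_of J_of_cI fun_eq_iff finite_cI)

lemma iota_inf_eq: "iota_inf a = E (J_of a)"
  unfolding iota_inf_def J_of_def[symmetric] by (simp add: exp_ad_J)

lemma iota_inf_hom: "iota_inf \<in> hom Cinf AutW"
  using J_of_add Cinf_mult_closed by (intro homI) (simp_all add: iota_inf_eq E_aut E_comp)

lemma iota_inf_bij: "bij_betw iota_inf (carrier Cinf) (E ` J)"
proof -
  have "bij_betw (E \<circ> J_of) (carrier Cinf) (E ` J)"
    using J_of_bij by (rule bij_betw_trans) (auto simp: bij_betw_def inj_on_def E_inj)
  then show ?thesis
    by (simp add: iota_inf_eq[abs_def] comp_def)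
qed

lemma iota_Z2_eq: "\<epsilon> \<in> carrier Z2 \<Longrightarrow> iota_Z2 \<epsilon> = U \<epsilon> 1 1"
  by (simp add: iota_Z2_def sigma_bar_U)

lemma iota_torus_eq: "a \<noteq> 0 \<Longrightarrow> \<mu> \<noteq> 0 \<Longrightarrow> iota_torus (a, \<mu>) = U 1 a \<mu>"
  by (simp add: iota_torus_def sigma_bar_U)

lemma iota_Z2_hom: "iota_Z2 \<in> hom Z2 AutW"
  by (rule homI) (auto simp: iota_Z2_eq U_aut U_comp)

lemma iota_torus_hom: "iota_torus \<in> hom (Cstar \<times>\<times> Cstar) AutW"
proof (rule homI)
  fix x y
  assume "x \<in> carrier (Cstar \<times>\<times> Cstar)" "y \<in> carrier (Cstar \<times>\<times> Cstar)"
  then obtain a b a' b' where "x = (a, b)" "y = (a', b')" "a \<noteq> 0" "b \<noteq> 0" "a' \<noteq> 0" "b' \<noteq> 0"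
    by force
  then show "iota_torus x \<in> carrier AutW"
    "iota_torus (x \<otimes>\<^bsub>Cstar \<times>\<times> Cstar\<^esub> y) = iota_torus x \<otimes>\<^bsub>AutW\<^esub> iota_torus y"
    by (simp_all add: iota_torus_eq U_aut U_comp mult.commute)
qed

lemma U_inj:
  assumes "\<epsilon> \<in> {1, -1}" "a \<noteq> 0" "\<mu> \<noteq> 0" "U \<epsilon> a \<mu> = U \<epsilon>' a' \<mu>'"
  shows "\<epsilon> = \<epsilon>'" "a = a'" "\<mu> = \<mu>'"
  using E_U_inj[of 0 0 \<epsilon> a \<mu> \<epsilon>' a' \<mu>'] assms by simp_all

lemma iota_Z2_iso: "iota_Z2 \<in> iso Z2 (AutW\<lparr>carrier := \<aa>\<rparr>)"
proof (rule iso_subgroup[OF iota_Z2_hom])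
  show "inj_on iota_Z2 (carrier Z2)"
    by (rule inj_onI) (metis U_inj(1) Z2_simps(1) iota_Z2_eq one_neq_zero)
  show "iota_Z2 ` carrier Z2 = \<aa>"
    by (auto simp: iota_Z2_def \<aa>_def)
qed

lemma iota_torus_iso: "iota_torus \<in> iso (Cstar \<times>\<times> Cstar) (AutW\<lparr>carrier := \<bb>\<rparr>)"
proof (rule iso_subgroup[OF iota_torus_hom])
  show "inj_on iota_torus (carrier (Cstar \<times>\<times> Cstar))"
  proof (rule inj_onI)
    fix x y
    assume "x \<in> carrier (Cstar \<times>\<times> Cstar)" "y \<in> carrier (Cstar \<times>\<times> Cstar)"
    then obtain a b a' b' where "x = (a, b)" "y = (a', b')" "a \<noteq> 0" "b \<noteq> 0" "a' \<noteq> 0" "b' \<noteq> 0"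
      by force
    moreover assume "iota_torus x = iota_torus y"
    ultimately show "x = y"
      using U_inj[of 1 a b 1 a' b'] by (simp add: iota_torus_eq)
  qed
  show "iota_torus ` carrier (Cstar \<times>\<times> Cstar) = \<bb>"
    by (auto simp: iota_torus_def \<bb>_def image_def)
qed

lemma iota_inf_iso: "iota_inf \<in> iso Cinf (AutW\<lparr>carrier := \<ZZ> <#>\<^bsub>AutW\<^esub> \<tt>\<rparr>)"
  using iota_inf_bij by (intro iso_subgroup[OF iota_inf_hom]) (auto simp: bij_betw_def ZZ_tt_eq)

text \<open>By \<open>U_comp\<close>, conjugation by the sign \<epsilon> sends (a, \<mu>) to
  (\<open>a powi \<epsilon>\<close>, \<mu>): the reflection inverts the first parameter and fixes
  the second.\<close>

lemma torus_acts: "acts_by_conj AutW (Cstar \<times>\<times> Cstar) Z2 iota_torus iota_Z2 torus_action"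
  unfolding torus_action_def
proof (rule acts_by_conj_conj_action)
  fix \<epsilon> b
  assume \<epsilon>: "\<epsilon> \<in> carrier Z2" and "b \<in> carrier (Cstar \<times>\<times> Cstar)"
  then obtain a \<mu> where b: "b = (a, \<mu>)" "a \<noteq> 0" "\<mu> \<noteq> 0"
    by auto
  have "inv\<^bsub>AutW\<^esub> (iota_Z2 \<epsilon>) = U \<epsilon> 1 1"
    using \<epsilon> by (intro inv_Aut_eq) (auto simp: iota_Z2_eq U_aut U_comp U_id)
  then have "iota_Z2 \<epsilon> \<otimes>\<^bsub>AutW\<^esub> iota_torus b \<otimes>\<^bsub>AutW\<^esub> inv\<^bsub>AutW\<^esub> (iota_Z2 \<epsilon>) = iota_torus (a powi \<epsilon>, \<mu>)"
    using \<epsilon> b by (auto simp: iota_Z2_eq iota_torus_eq U_comp)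
  then show "iota_Z2 \<epsilon> \<otimes>\<^bsub>AutW\<^esub> iota_torus b \<otimes>\<^bsub>AutW\<^esub> inv\<^bsub>AutW\<^esub> (iota_Z2 \<epsilon>)
      \<in> iota_torus ` carrier (Cstar \<times>\<times> Cstar)"
    using b by auto
qed

lemma iota_K_hom: "iota_K \<in> hom K AutW"
  unfolding iota_K_def K_def
  by (rule semidirect_hom[OF group_Aut iota_torus_hom iota_Z2_hom torus_acts])

lemma carrier_K: "carrier K = ((UNIV - {0}) \<times> (UNIV - {0})) \<times> {1, -1}"
  by (simp add: K_def semidirect_def)

lemma iota_K_eq:
  "a \<noteq> 0 \<Longrightarrow> \<mu> \<noteq> 0 \<Longrightarrow> \<epsilon> \<in> {1, -1} \<Longrightarrow> iota_K ((a, \<mu>), \<epsilon>) = U \<epsilon> (a powi \<epsilon>) \<mu>"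
  by (simp add: iota_K_def iota_torus_eq iota_Z2_eq U_comp)

text \<open>By \<open>E_conj\<close>, conjugation by an automorphism f turns \<open>E x\<close> into
  \<open>E (f x)\<close>, and f preserves \<open>J\<close>.\<close>

lemma K_acts: "acts_by_conj AutW Cinf K iota_inf iota_K K_action"
  unfolding K_action_def
proof (rule acts_by_conj_conj_action)
  fix k a
  assume "k \<in> carrier K" "a \<in> carrier Cinf"
  then have k: "iota_K k \<in> carrier AutW"
    using hom_in_carrier[OF iota_K_hom] by blast
  interpret group AutW by (rule group_Aut)
  have J: "iota_K k (J_of a) \<in> J"
    using aut_J_iff[OF k] by simp
  have "iota_K k \<circ> E (J_of a) \<circ> inv\<^bsub>AutW\<^esub> iota_K k
      = E (iota_K k (J_of a)) \<circ> (iota_K k \<circ> inv\<^bsub>AutW\<^esub> iota_K k)"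
    by (simp only: E_conj[OF k] comp_assoc)
  also have "iota_K k \<circ> inv\<^bsub>AutW\<^esub> iota_K k = id"
    using r_inv[OF k] by simp
  finally have "iota_K k \<circ> E (J_of a) \<circ> inv\<^bsub>AutW\<^esub> iota_K k = E (iota_K k (J_of a))"
    by (simp only: comp_id)
  then show "iota_K k \<otimes>\<^bsub>AutW\<^esub> iota_inf a \<otimes>\<^bsub>AutW\<^esub> inv\<^bsub>AutW\<^esub> iota_K k \<in> iota_inf ` carrier Cinf"
    unfolding bij_betw_imp_surj_on[OF iota_inf_bij] iota_inf_eq lie_aut_simps using J by (rule image_eqI)
qed

lemma identifications_hold: "identifications_valid"
  unfolding identifications_valid_def
  using iota_Z2_iso iota_torus_iso iota_inf_iso torus_acts K_acts by blast

lemma Cinf_K_iso: "(\<lambda>(a, k). iota_inf a \<otimes>\<^bsub>AutW\<^esub> iota_K k) \<in> iso Cinf_K AutW" (is "?h \<in> _")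
proof -
  have hom: "?h \<in> hom Cinf_K AutW"
    unfolding Cinf_K_def by (rule semidirect_hom[OF group_Aut iota_inf_hom iota_K_hom K_acts])
  have carrier: "carrier Cinf_K = carrier Cinf \<times> (((UNIV - {0}) \<times> (UNIV - {0})) \<times> {1, -1})"
    by (simp add: Cinf_K_def semidirect_def carrier_K)
  have inj: "inj_on ?h (carrier Cinf_K)"
  proof (rule inj_onI)
    fix x y
    assume xy: "x \<in> carrier Cinf_K" "y \<in> carrier Cinf_K" and eq: "?h x = ?h y"
    obtain c a \<mu> \<epsilon> c' a' \<mu>' \<epsilon>' where x: "x = (c, ((a, \<mu>), \<epsilon>))" "y = (c', ((a', \<mu>'), \<epsilon>'))"
      by (metis surj_pair)
    have c: "c \<in> carrier Cinf" "c' \<in> carrier Cinf"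
      and nz: "a \<noteq> 0" "\<mu> \<noteq> 0" "\<epsilon> \<in> {1, -1}" "a' \<noteq> 0" "\<mu>' \<noteq> 0" "\<epsilon>' \<in> {1, -1}"
      using xy by (simp_all add: carrier x)
    have eq': "E (J_of c) \<circ> U \<epsilon> (a powi \<epsilon>) \<mu> = E (J_of c') \<circ> U \<epsilon>' (a' powi \<epsilon>') \<mu>'"
      using eq by (simp add: x iota_inf_eq iota_K_eq[OF nz(1-3)] iota_K_eq[OF nz(4-6)])
    have "a powi \<epsilon> \<noteq> 0"
      using nz(1) by simp
    note eqs = E_U_inj[OF J_of_J J_of_J nz(3) this nz(2) eq']
    have "c = c'"
      using inj_onD[OF bij_betw_imp_inj_on[OF J_of_bij] eqs(1) c] .
    moreover have "a = a'"
      using eqs(2,3) nz(3) by (auto simp: power_int_minus)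
    ultimately show "x = y"
      using eqs(2,4) by (simp add: x)
  qed
  have "f \<in> ?h ` carrier Cinf_K" if f: "f \<in> carrier AutW" for f
  proof -
    obtain x \<epsilon> a \<mu> where x: "x \<in> J" "\<epsilon> \<in> {1, -1}" "a \<noteq> 0" "\<mu> \<noteq> 0" "f = E x \<circ> U \<epsilon> a \<mu>"
      by (rule aut_classification[OF f])
    \<comment> \<open>\<open>iota_K\<close> raises the first torus parameter to the power
      \<epsilon>, so the preimage must use \<open>a powi \<epsilon>\<close> in place of
      \<open>a\<close>.\<close>
    have "(a powi \<epsilon>) powi \<epsilon> = a"
      using x(2) by (auto simp: power_int_minus)
    then have "f = ?h (cI x, ((a powi \<epsilon>, \<mu>), \<epsilon>))"
      using x iota_K_eq[of "a powi \<epsilon>" \<mu> \<epsilon>] by (simp add: iota_inf_eq J_of_cI)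
    moreover have "(cI x, ((a powi \<epsilon>, \<mu>), \<epsilon>)) \<in> carrier Cinf_K"
      using x by (simp add: carrier finite_cI)
    ultimately show ?thesis
      by (rule image_eqI)
  qed
  with hom inj show ?thesis
    using hom_carrier[OF hom] by (auto simp: iso_iff)
qed

lemma AutW_iso_Cinf_K: "AutW \<cong> Cinf_K"
proof -
  have "k \<otimes>\<^bsub>K\<^esub> l \<in> carrier K" if "k \<in> carrier K" "l \<in> carrier K" for k l
    using that unfolding K_def by (rule semidirect_mult_closed[OF torus_acts, rotated 2]) auto
  then have "x \<otimes>\<^bsub>Cinf_K\<^esub> y \<in> carrier Cinf_K" if "x \<in> carrier Cinf_K" "y \<in> carrier Cinf_K" for x y
    using that unfolding Cinf_K_def by (intro semidirect_mult_closed[OF K_acts] Cinf_mult_closed)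
  then show ?thesis
    using iso_inv_into[OF Cinf_K_iso] unfolding is_iso_def by blast
qed

end

section \<open>Automorphisms of the central extension\<close>

sublocale Wt_algebra \<subseteq> basis: indexed_basis scale "case_sum (case_sum L I) (case_bool C1 C2)"
  by unfold_locales (fact basis_inj basis_independent basis_span)+

context Wt_algebra
begin

lemma Wt_induct [case_names L I C1 C2 add scale]:
  assumes "\<And>n. P (L n)" "\<And>n. P (I n)" "P C1" "P C2"
    and "\<And>x y. P x \<Longrightarrow> P y \<Longrightarrow> P (x + y)" "\<And>c x. P x \<Longrightarrow> P (c *s x)"
  shows "P x"
proof (induction x rule: basis.basis_induct)
  case (basis i)
  then show ?case
    using assms(1-4) by (auto split: sum.splits bool.splits)
qed (use assms in blast)+

lemma Wt_linear_extension:
  assumes "vector_space scale'"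
  obtains f where "Vector_Spaces.linear scale scale' f"
    "\<And>n. f (L n) = l n" "\<And>n. f (I n) = j n" "f C1 = c1" "f C2 = c2"
proof -
  obtain f where f: "Vector_Spaces.linear scale scale' f"
    "\<And>i. f (case_sum (case_sum L I) (case_bool C1 C2) i) = case_sum (case_sum l j) (case_bool c1 c2) i"
    by (rule basis.linear_extension[OF assms, of "case_sum (case_sum l j) (case_bool c1 c2)"]) blast
  show thesis
    by (rule that[OF f(1)])
      (use f(2)[of "Inl (Inl _)"] f(2)[of "Inl (Inr _)"] f(2)[of "Inr True"] f(2)[of "Inr False"] in simp_all)
qed

lemma bracket_C_right: "bracket x C1 = 0" "bracket x C2 = 0"
  using bracket_sym[of x C1] bracket_sym[of x C2] by (simp_all add: bracket_C1 bracket_C2)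

text \<open>The central term has the same form as in [L_m, I_n] because m^3 - m is odd: for n = -m
  the two sign changes cancel.\<close>

lemma bracket_I_L: "bracket (I m) (L n) =
    of_int (m - n) *s I (m + n) + (if m + n = 0 then (of_int (m ^ 3 - m) / 12) *s C2 else 0)"
proof (cases "m + n = 0")
  case True
  then have "n = - m"
    by simp
  then show ?thesis
    using bracket_sym[of "I m" "L n"]
    by (simp add: bracket_L_I flip: scale_minus_left) (simp add: field_simps)
next
  case False
  then show ?thesis
    using bracket_sym[of "I m" "L n"]
    by (simp add: bracket_L_I add.commute flip: scale_minus_left)
qed

text \<open>Perfectness of the extension as an induction rule: every element is a combination of
  brackets.\<close>

lemma Wt_perfect_induct [case_names bracket add scale]:
  assumes br: "\<And>x y. P (bracket x y)"
    and add: "\<And>x y. P x \<Longrightarrow> P y \<Longrightarrow> P (x + y)" and scale: "\<And>c x. P x \<Longrightarrow> P (c *s x)"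
  shows "P x"
proof (induction x rule: Wt_induct)
  show PL: "P (L n)" for n
  proof (cases "n = 0")
    case True
    then have "L n = (1 / 2) *s bracket (L 1) (L (- 1))"
      by (simp add: bracket_L_L)
    then show ?thesis
      by (rule ssubst[where P = P]) (rule scale[OF br])
  next
    case False
    then have "L n = (1 / of_int n) *s bracket (L n) (L 0)"
      by (simp add: bracket_L_L)
    then show ?thesis
      by (rule ssubst[where P = P]) (rule scale[OF br])
  qed
  show PI: "P (I n)" for n
  proof (cases "n = 0")
    case True
    then have "I n = (1 / 2) *s bracket (L 1) (I (- 1))"
      by (simp add: bracket_L_I)
    then show ?thesis
      by (rule ssubst[where P = P]) (rule scale[OF br])
  next
    case False
    then have "I n = (1 / of_int n) *s bracket (L n) (I 0)"
      by (simp add: bracket_L_I)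
    then show ?thesis
      by (rule ssubst[where P = P]) (rule scale[OF br])
  qed
  \<comment> \<open>The cocycle vanishes for m = 0, 1, -1, so m = 2 is the first useful index: (8 -
    2) / 12 = 1/2, and [L_2, L_{-2}] = 4 L_0 + C_1 / 2. The same computation gives C_2
    below.\<close>
  have "C1 = 2 *s bracket (L 2) (L (- 2)) + (- 8) *s L 0"
    by (simp add: bracket_L_L scale_right_distrib)
  then show "P C1"
    by (rule ssubst[where P = P]) (rule add[OF scale[OF br] scale[OF PL]])
  have "C2 = 2 *s bracket (L 2) (I (- 2)) + (- 8) *s I 0"
    by (simp add: bracket_L_I scale_right_distrib)
  then show "P C2"
    by (rule ssubst[where P = P]) (rule add[OF scale[OF br] scale[OF PI]])
qed (use assms in blast)+

definition center :: "'a set" where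
  "center = {z. \<forall>y. bracket z y = 0}"

lemma center_closed:
  "z \<in> center \<Longrightarrow> w \<in> center \<Longrightarrow> z + w \<in> center" "z \<in> center \<Longrightarrow> c *s z \<in> center"
  by (simp_all add: center_def bracket_add_left bracket_scale_left)

lemma aut_center:
  assumes F: "F \<in> carrier Aut" and "z \<in> center"
  shows "F z \<in> center"
proof -
  have "bracket (F z) y = 0" for y
  proof -
    obtain x where "y = F x"
      using bij_is_surj[OF aut_bij[OF F]] by blast
    then show ?thesis
      using \<open>z \<in> center\<close>
      by (simp add: center_def linear_zero[OF aut_linear[OF F]] flip: aut_bracket[OF F])
  qed
  then show ?thesis
    by (simp add: center_def)
qed

text \<open>Central changes of its arguments do not affect a bracket, so \<open>F\<close> and
  \<open>G\<close> agree on all brackets, and these span by perfectness.\<close>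

lemma aut_eqI:
  assumes F: "F \<in> carrier Aut" and G: "G \<in> carrier Aut" and diff: "\<And>x. F x - G x \<in> center"
  shows "F = G"
proof
  show "F x = G x" for x
  proof (induction x rule: Wt_perfect_induct)
    case (bracket x y)
    have "bracket (F x - G x) (F y) = 0" "bracket (G x) (F y - G y) = 0"
      using diff bracket_sym[of "G x" "F y - G y"] by (auto simp: center_def)
    then have "bracket (F x) (F y) = bracket (G x) (F y)" "bracket (G x) (F y) = bracket (G x) (G y)"
      by (simp_all add: bracket_diff_left bracket_diff_right)
    then show ?case
      by (simp add: aut_bracket[OF F] aut_bracket[OF G])
  qed (simp_all add: linear_add[OF aut_linear[OF F]] linear_add[OF aut_linear[OF G]]
      linear_scale[OF aut_linear[OF F]] linear_scale[OF aut_linear[OF G]])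
qed

text \<open>[I_k, y] is a combination of the I_n and C_2, which every I_i annihilates. This provides
  the hypothesis of \<open>aut_id_plus_ad\<close> for lifting exp(ad x).\<close>

lemma ad_sum_I_square:
  assumes "x = (\<Sum>i\<in>S. c i *s I i)"
  shows "bracket x (bracket x y) = 0"
proof -
  have "bracket (I i) (bracket (I k) y) = 0" for i k
    by (induction y rule: Wt_induct)
      (auto simp: bracket_I_L bracket_I_I bracket_C_right bracket_add_right bracket_scale_right)
  then have "bracket (I i) (bracket x y) = 0" for i
    unfolding assms linear_sum[OF linear_bracket_left]
    by (simp add: linear_sum[OF linear_bracket] bracket_scale_left bracket_scale_right)
  moreover have "bracket x z = (\<Sum>i\<in>S. c i *s bracket (I i) z)" for z
    unfolding assms linear_sum[OF linear_bracket_left] by (simp add: bracket_scale_left)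
  ultimately show ?thesis
    by simp
qed

text \<open>The scalars on C_1 and C_2 are forced by the central term of [L_m, L_{-m}] and
  [L_m, I_{-m}]: oddness of m^3 - m yields one factor \<epsilon>, the images of the L's yield
  \<epsilon> each, and the image of I yields \<mu>.\<close>

lemma aut_standard:
  assumes \<epsilon>: "\<epsilon> \<in> {1, -1}" and "a \<noteq> 0" "\<mu> \<noteq> 0"
  obtains F where "F \<in> carrier Aut" "\<And>n. F (L n) = (a powi n * of_int \<epsilon>) *s L (\<epsilon> * n)"
    "\<And>n. F (I n) = (a powi n * \<mu>) *s I (\<epsilon> * n)" "F C1 = of_int \<epsilon> *s C1" "F C2 = \<mu> *s C2"
proof -
  obtain F where F: "Vector_Spaces.linear scale scale F"
    "\<And>n. F (L n) = (a powi n * of_int \<epsilon>) *s L (\<epsilon> * n)"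
    "\<And>n. F (I n) = (a powi n * \<mu>) *s I (\<epsilon> * n)" "F C1 = of_int \<epsilon> *s C1" "F C2 = \<mu> *s C2"
    by (rule Wt_linear_extension[OF vector_space_axioms, of "\<lambda>n. (a powi n * of_int \<epsilon>) *s L (\<epsilon> * n)"
          "\<lambda>n. (a powi n * \<mu>) *s I (\<epsilon> * n)" "of_int \<epsilon> *s C1" "\<mu> *s C2"]) blast
  \<comment> \<open>Parameters of the inverse map, as in \<open>U_inverse\<close>; the explicit
    inverse \<open>G\<close> gives bijectivity.\<close>
  define b \<nu> where "b = a powi - \<epsilon>" and "\<nu> = inverse \<mu>"
  obtain G where G: "Vector_Spaces.linear scale scale G"
    "\<And>n. G (L n) = (b powi n * of_int \<epsilon>) *s L (\<epsilon> * n)"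
    "\<And>n. G (I n) = (b powi n * \<nu>) *s I (\<epsilon> * n)" "G C1 = of_int \<epsilon> *s C1" "G C2 = \<nu> *s C2"
    by (rule Wt_linear_extension[OF vector_space_axioms, of "\<lambda>n. (b powi n * of_int \<epsilon>) *s L (\<epsilon> * n)"
          "\<lambda>n. (b powi n * \<nu>) *s I (\<epsilon> * n)" "of_int \<epsilon> *s C1" "\<nu> *s C2"]) blast
  have b: "b = (if \<epsilon> = 1 then inverse a else a)"
    using \<epsilon> by (auto simp: b_def power_int_minus)
  have "F (G x) = x" for x
    by (induction x rule: Wt_induct)
      (use assms in \<open>(auto simp: F G linear_add[OF F(1)] linear_add[OF G(1)] linear_scale[OF F(1)]
        linear_scale[OF G(1)] linear_neg[OF F(1)] b \<nu>_def power_int_minus power_int_inverse,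
        (simp add: field_simps)+)\<close>)
  moreover have "G (F x) = x" for x
    by (induction x rule: Wt_induct)
      (use assms in \<open>(auto simp: F G linear_add[OF F(1)] linear_add[OF G(1)] linear_scale[OF F(1)]
        linear_scale[OF G(1)] linear_neg[OF G(1)] b \<nu>_def power_int_minus power_int_inverse,
        (simp add: field_simps)+)\<close>)
  ultimately have bij: "bij F"
    by (intro o_bij[of G]) (simp_all add: fun_eq_iff)
  note simps = F bracket_L_L bracket_L_I bracket_I_L bracket_scale_left bracket_scale_right
    linear_add[OF F(1)] linear_scale[OF F(1)] linear_zero[OF F(1)] scale_right_distrib
  have LL: "F (bracket (L m) (L n)) = bracket (F (L m)) (F (L n))"
    and LI: "F (bracket (L m) (I n)) = bracket (F (L m)) (F (I n))"
    and IL: "F (bracket (I m) (L n)) = bracket (F (I m)) (F (L n))" for m n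
  proof -
    \<comment> \<open>For \<epsilon> = -1 the images have degrees -m and -n, and this rules out a
      central term in their bracket.\<close>
    have ne: "- m - n \<noteq> 0" if "m + n \<noteq> 0"
      using that by linarith
    have cancel: "inverse (a powi k) * (a powi k * z) = z"
      "inverse (a powi k) * \<mu> * (a powi k * z) = \<mu> * z"
      "inverse (a powi k) * (a powi k * \<mu> * z) = \<mu> * z" for k z
      using \<open>a \<noteq> 0\<close> by simp_all
    show "F (bracket (L m) (L n)) = bracket (F (L m)) (F (L n))"
    proof (cases "m + n = 0")
      case True
      then have "n = - m"
        by simp
      then show ?thesis
        using \<epsilon> \<open>a \<noteq> 0\<close>
        by (auto simp: simps power_int_minus cancel; simp add: algebra_simps diff_divide_distrib)
    next
      case False
      then show ?thesis
        using \<epsilon> ne \<open>a \<noteq> 0\<close>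
        by (auto simp: simps; auto simp: power_int_add algebra_simps)
    qed
    show "F (bracket (L m) (I n)) = bracket (F (L m)) (F (I n))"
    proof (cases "m + n = 0")
      case True
      then have "n = - m"
        by simp
      then show ?thesis
        using \<epsilon> \<open>a \<noteq> 0\<close>
        by (auto simp: simps power_int_minus cancel; simp add: algebra_simps diff_divide_distrib)
    next
      case False
      then show ?thesis
        using \<epsilon> ne \<open>a \<noteq> 0\<close>
        by (auto simp: simps; auto simp: power_int_add algebra_simps)
    qed
    show "F (bracket (I m) (L n)) = bracket (F (I m)) (F (L n))"
    proof (cases "m + n = 0")
      case True
      then have "n = - m"
        by simp
      then show ?thesis
        using \<epsilon> \<open>a \<noteq> 0\<close>
        by (auto simp: simps power_int_minus cancel; simp add: algebra_simps diff_divide_distrib)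
    next
      case False
      then show ?thesis
        using \<epsilon> ne \<open>a \<noteq> 0\<close>
        by (auto simp: simps; auto simp: power_int_add algebra_simps)
    qed
  qed
  have "F (bracket (case_sum (case_sum L I) (case_bool C1 C2) i) (case_sum (case_sum L I) (case_bool C1 C2) j))
      = bracket (F (case_sum (case_sum L I) (case_bool C1 C2) i)) (F (case_sum (case_sum L I) (case_bool C1 C2) j))"
    for i j
    using LL LI IL
    by (auto split: sum.splits bool.splits simp: bracket_C_right bracket_C1 bracket_C2 F(3-5) bracket_I_I
        bracket_scale_left bracket_scale_right linear_zero[OF F(1)])
  then have "F (bracket x y) = bracket (F x) (F y)" for x y
    by (rule basis.preserves_bracket[OF lie_algebra_axioms lie_algebra_axioms F(1)])
  then show thesis
    using that[of F] F bij by (simp add: lie_aut_iff)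
qed

end

section \<open>The projection onto W and the induced map of automorphism groups\<close>

locale central_extension = W: W_algebra scale bracket L I + V: Wt_algebra scale' bracket' L' I' C1 C2
  for scale :: "complex \<Rightarrow> 'w::ab_group_add \<Rightarrow> 'w" and bracket L I
    and scale' :: "complex \<Rightarrow> 'v::ab_group_add \<Rightarrow> 'v" and bracket' L' I' C1 C2
begin

definition proj :: "'v \<Rightarrow> 'w" where
  "proj = (SOME f. Vector_Spaces.linear scale' scale f \<and> (\<forall>n. f (L' n) = L n) \<and> (\<forall>n. f (I' n) = I n)
     \<and> f C1 = 0 \<and> f C2 = 0)"

text \<open>Only a linear section: it does not respect brackets, but it is used up to central
  elements.\<close>

definition sect :: "'w \<Rightarrow> 'v" where
  "sect = (SOME f. Vector_Spaces.linear scale scale' f \<and> (\<forall>n. f (L n) = L' n) \<and> (\<forall>n. f (I n) = I' n))"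

lemma
  shows linear_proj: "Vector_Spaces.linear scale' scale proj"
    and proj_simps [simp]: "proj (L' n) = L n" "proj (I' n) = I n" "proj C1 = 0" "proj C2 = 0"
proof -
  have "\<exists>f. Vector_Spaces.linear scale' scale f \<and> (\<forall>n. f (L' n) = L n) \<and> (\<forall>n. f (I' n) = I n)
     \<and> f C1 = 0 \<and> f C2 = 0"
    by (rule V.Wt_linear_extension[OF W.vector_space_axioms, of L I 0 0]) blast
  from someI_ex[OF this, folded proj_def] show "Vector_Spaces.linear scale' scale proj"
    "proj (L' n) = L n" "proj (I' n) = I n" "proj C1 = 0" "proj C2 = 0"
    by blast+
qed

lemma
  shows linear_sect: "Vector_Spaces.linear scale scale' sect"
    and sect_simps [simp]: "sect (L n) = L' n" "sect (I n) = I' n"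
proof -
  obtain f where f: "Vector_Spaces.linear scale scale' f" "\<And>i. f (case_sum L I i) = case_sum L' I' i"
    by (rule W.basis.linear_extension[OF V.vector_space_axioms, of "case_sum L' I'"]) blast
  then have "f (L n) = L' n" "f (I n) = I' n" for n
    using f(2)[of "Inl n"] f(2)[of "Inr n"] by simp_all
  with f(1) have "\<exists>f. Vector_Spaces.linear scale scale' f \<and> (\<forall>n. f (L n) = L' n) \<and> (\<forall>n. f (I n) = I' n)"
    by blast
  from someI_ex[OF this, folded sect_def] show "Vector_Spaces.linear scale scale' sect"
    "sect (L n) = L' n" "sect (I n) = I' n"
    by blast+
qed

lemma proj_sect [simp]: "proj (sect x) = x"
  by (induction x rule: W.W_induct)
    (simp_all add: linear_add[OF linear_proj] linear_add[OF linear_sect] linear_scale[OF linear_proj]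
      linear_scale[OF linear_sect])

lemma proj_bracket: "proj (bracket' x y) = bracket (proj x) (proj y)"
proof (rule V.basis.preserves_bracket[OF V.lie_algebra_axioms W.lie_algebra_axioms linear_proj])
  show "proj (bracket' (case_sum (case_sum L' I') (case_bool C1 C2) i) (case_sum (case_sum L' I') (case_bool C1 C2) j))
      = bracket (proj (case_sum (case_sum L' I') (case_bool C1 C2) i)) (proj (case_sum (case_sum L' I') (case_bool C1 C2) j))"
    for i j
    by (auto split: sum.splits bool.splits simp: V.bracket_L_L V.bracket_L_I V.bracket_I_L V.bracket_I_I
        V.bracket_C1 V.bracket_C2 V.bracket_C_right W.bracket_L_L W.bracket_L_I W.bracket_I_L W.bracket_I_I
        linear_add[OF linear_proj] linear_scale[OF linear_proj] linear_zero[OF linear_proj])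
qed

lemma diff_sect_proj: "x - sect (proj x) \<in> V.center"
proof (induction x rule: V.Wt_induct)
  case (add x y)
  have "x + y - sect (proj (x + y)) = (x - sect (proj x)) + (y - sect (proj y))"
    by (simp add: linear_add[OF linear_proj] linear_add[OF linear_sect])
  then show ?case
    by (rule ssubst[where P = "\<lambda>z. z \<in> V.center"]) (rule V.center_closed(1)[OF add])
next
  case (scale c x)
  have "scale' c x - sect (proj (scale' c x)) = scale' c (x - sect (proj x))"
    by (simp add: linear_scale[OF linear_proj] linear_scale[OF linear_sect] V.scale_right_diff_distrib)
  then show ?case
    by (rule ssubst[where P = "\<lambda>z. z \<in> V.center"]) (rule V.center_closed(2)[OF scale])
qed (simp_all add: V.center_def V.bracket_C1 V.bracket_C2 linear_zero[OF linear_sect])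

text \<open>Forward, \<open>proj\<close> is onto and W has trivial center; backward,
  \<open>z\<close> then equals its own central defect \<open>z - sect (proj z)\<close>.\<close>

lemma center_iff: "z \<in> V.center \<longleftrightarrow> proj z = 0"
proof
  assume z: "z \<in> V.center"
  have "bracket (proj z) y = proj (bracket' z (sect y))" for y
    by (simp add: proj_bracket)
  then show "proj z = 0"
    using z by - (rule W.center_W, simp add: V.center_def linear_zero[OF linear_proj])
next
  assume "proj z = 0"
  then show "z \<in> V.center"
    using diff_sect_proj[of z] by (simp add: linear_zero[OF linear_sect])
qed

definition induced :: "('v \<Rightarrow> 'v) \<Rightarrow> 'w \<Rightarrow> 'w" where
  "induced F = proj \<circ> F \<circ> sect"

text \<open>Independence of the section: \<open>x\<close> and \<open>sect (proj x)\<close> differ by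
  a central element, which \<open>F\<close> keeps central and \<open>proj\<close> kills.\<close>

lemma induced_proj:
  assumes F: "F \<in> carrier V.Aut"
  shows "induced F (proj x) = proj (F x)"
  using V.aut_center[OF F diff_sect_proj[of x]]
  by (simp add: center_iff induced_def linear_diff[OF V.aut_linear[OF F]] linear_diff[OF linear_proj])

lemma induced_comp:
  assumes "F \<in> carrier V.Aut"
  shows "induced (F \<circ> G) = induced F \<circ> induced G"
  using induced_proj[OF assms] by (simp add: induced_def fun_eq_iff)

lemma induced_aut:
  assumes F: "F \<in> carrier V.Aut"
  shows "induced F \<in> carrier W.AutW"
proof -
  define G where "G = inv_into UNIV F"
  have G: "G \<in> carrier V.Aut" "F \<circ> G = id" "G \<circ> F = id"
    using V.aut_inv[OF F] V.aut_bij[OF F] bij_is_inj[of F] bij_is_surj[of F]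
    by (simp_all add: G_def surj_iff)
  have id: "induced id = id"
    by (simp add: induced_def fun_eq_iff)
  have "bij (induced F)"
    by (rule o_bij[of "induced G"]) (simp_all add: G id flip: induced_comp[OF F] induced_comp[OF G(1)])
  moreover have "Vector_Spaces.linear scale scale (induced F)"
    unfolding induced_def by (intro linear_comp[OF linear_sect] linear_comp[OF V.aut_linear[OF F]] linear_proj)
  moreover have "induced F (bracket x y) = bracket (induced F x) (induced F y)" for x y
    using induced_proj[OF F, of "bracket' (sect x) (sect y)"]
    by (simp add: proj_bracket V.aut_bracket[OF F]) (simp add: induced_def)
  ultimately show ?thesis
    by (simp add: lie_aut_iff)
qed

lemma induced_eqI:
  assumes "\<And>x. proj (F x) = f (proj x)"
  shows "induced F = f"
  by (simp add: induced_def fun_eq_iff assms)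

text \<open>The lift is id + ad of \<open>sect x\<close>, a combination of the I_n in the extension;
  \<open>proj\<close> intertwines the two adjoint maps.\<close>

lemma induced_E:
  assumes "x \<in> W.J"
  obtains F where "F \<in> carrier V.Aut" "induced F = W.E x"
proof -
  have "sect x = (\<Sum>i | W.cI x i \<noteq> 0. scale' (W.cI x i) (I' i))"
    using arg_cong[OF W.J_expansion[OF assms W.finite_cI, of x], of sect]
    by (simp add: linear_sum[OF linear_sect] linear_scale[OF linear_sect])
  then have "(\<lambda>y. y + bracket' (sect x) y) \<in> carrier V.Aut"
    by (intro V.aut_id_plus_ad V.ad_sum_I_square) simp_all
  moreover have "induced (\<lambda>y. y + bracket' (sect x) y) = W.E x"
    by (rule induced_eqI) (simp add: linear_add[OF linear_proj] proj_bracket W.E_def)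
  ultimately show thesis
    by (rule that)
qed

lemma induced_U:
  assumes "\<epsilon> \<in> {1, -1}" "a \<noteq> 0" "\<mu> \<noteq> 0"
  obtains F where "F \<in> carrier V.Aut" "induced F = W.U \<epsilon> a \<mu>"
proof -
  obtain F where F: "F \<in> carrier V.Aut"
    "\<And>n. F (L' n) = scale' (a powi n * of_int \<epsilon>) (L' (\<epsilon> * n))"
    "\<And>n. F (I' n) = scale' (a powi n * \<mu>) (I' (\<epsilon> * n))" "F C1 = scale' (of_int \<epsilon>) C1" "F C2 = scale' \<mu> C2"
    by (rule V.aut_standard[OF assms]) blast
  have "proj (F x) = W.U \<epsilon> a \<mu> (proj x)" for x
    by (induction x rule: V.Wt_induct)
      (simp_all add: F W.U_L W.U_I linear_scale[OF linear_proj] linear_add[OF linear_proj]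
        linear_add[OF W.U_linear] linear_scale[OF W.U_linear] linear_zero[OF W.U_linear]
        linear_add[OF V.aut_linear[OF F(1)]] linear_scale[OF V.aut_linear[OF F(1)]])
  then show thesis
    by (intro that[OF F(1)] induced_eqI)
qed

lemma induced_iso: "induced \<in> iso V.Aut W.AutW"
proof -
  have "induced \<in> hom V.Aut W.AutW"
    by (rule homI) (simp_all add: induced_aut induced_comp)
  moreover have "inj_on induced (carrier V.Aut)"
  proof (rule inj_onI)
    fix F G
    assume F: "F \<in> carrier V.Aut" and G: "G \<in> carrier V.Aut" and eq: "induced F = induced G"
    have "proj (F x) = proj (G x)" for x
      using induced_proj[OF F, of x] induced_proj[OF G, of x] eq by simp
    then show "F = G"
      by (intro V.aut_eqI F G) (simp add: center_iff linear_diff[OF linear_proj])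
  qed
  moreover have "f \<in> induced ` carrier V.Aut" if f: "f \<in> carrier W.AutW" for f
  proof -
    obtain x \<epsilon> a \<mu> where "x \<in> W.J" "\<epsilon> \<in> {1, -1}" "a \<noteq> 0" "\<mu> \<noteq> 0" and feq: "f = W.E x \<circ> W.U \<epsilon> a \<mu>"
      by (rule W.aut_classification[OF f])
    then obtain F G where F: "F \<in> carrier V.Aut" "induced F = W.E x"
      and G: "G \<in> carrier V.Aut" "induced G = W.U \<epsilon> a \<mu>"
      using induced_E induced_U by metis
    then have "f = induced (F \<circ> G)"
      by (simp add: feq induced_comp)
    then show ?thesis
      using V.aut_comp[OF F(1) G(1)] by blast
  qed
  ultimately show ?thesis
    using induced_aut by (auto simp: iso_iff)
qed

end

theorem mainTheorem6:
  fixes scale :: "complex \<Rightarrow> 'w::ab_group_add \<Rightarrow> 'w"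
    and bracket :: "'w \<Rightarrow> 'w \<Rightarrow> 'w"
    and L I :: "int \<Rightarrow> 'w"
    and scale' :: "complex \<Rightarrow> 'v::ab_group_add \<Rightarrow> 'v"
    and bracket' :: "'v \<Rightarrow> 'v \<Rightarrow> 'v"
    and L' I' :: "int \<Rightarrow> 'v"
    and C1 C2 :: 'v
  assumes "W_algebra scale bracket L I"
    and "Wt_algebra scale' bracket' L' I' C1 C2"
  shows "lie_aut scale' bracket' \<cong> lie_aut scale bracket \<and>
         W_algebra.identifications_valid scale bracket L I \<and>
         lie_aut scale' bracket' \<cong> W_algebra.Cinf_K scale bracket L I"
proof -
  interpret central_extension scale bracket L I scale' bracket' L' I' C1 C2
    using assms by (rule central_extension.intro)
  have iso: "lie_aut scale' bracket' \<cong> lie_aut scale bracket"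
    using induced_iso by (auto simp: is_iso_def)
  then show ?thesis
    using W.identifications_hold iso_trans[OF iso W.AutW_iso_Cinf_K] by blast
qed

end
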